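(* Let $s>2$ be a real number, let $C_s>0$ be sufficiently small that the numbers $\alpha_i:=C_s/i^s$ $(i\ge1)$ satisfy $3\sum_{i=1}^\infty\alpha_i<\pi$. Let $E\subset S^1\subset\mathbb R^2$ be a centrally symmetric set of points such that the angles between consecutive points are $\alpha_1,\alpha_1,\alpha_1,\alpha_2,\alpha_2,\alpha_2,\ldots$ (each angle appearing three times); that is, up to rotation, $E=E_0\cup(-E_0)$, where $E_0=\{(\cos\theta_j,\sin\theta_j):j\ge0\}$ with $\theta_0=0$ and successive differences $\theta_{j+1}-\theta_j$ equal to $\alpha_1,\alpha_1,\alpha_1,\alpha_2,\alpha_2,\alpha_2,\alpha_3,\ldots$. Let $K$ be the closed convex hull of $E$. Then $$0<\frac1s\le\underline{\operatorname{Ent}}\,K\le\overline{\operatorname{Ent}}\,K\le\frac{2s-2}{3s-4}<1.$$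
   Context: For a plane convex body $K$ (compact convex with non-empty interior) and distinct $x,y\in\operatorname{int}K$, let $a,b$ be the intersection points of the line $xy$ with $\partial K$, in the order $a,x,y,b$. The Hilbert distance is $d(x,y)=\frac12\log\frac{|a-y|\,|b-x|}{|a-x|\,|b-y|}$. It is induced by the Finsler norm $\|v\|_x=\frac12\left(\frac1{t_1}+\frac1{t_2}\right)$ for $v\ne0$, where $t_1,t_2>0$ and $x+t_1v,\ x-t_2v\in\partial K$. The Busemann volume is $\operatorname{Vol}(A)=\int_A\sigma\,d\mathcal L$ with $\sigma(x)=\pi/\mathcal L(\{v:\|v\|_x\le1\})$ and $\mathcal L$ the Lebesgue measure on $\mathbb R^2$. With $B(o,r)$ the metric ball around any $o\in\operatorname{int}K$, $\overline{\operatorname{Ent}}\,K=\limsup_{r\to\infty}\frac{\log\operatorname{Vol}B(o,r)}{r}$ and $\underline{\operatorname{Ent}}\,K=\liminf_{r\to\infty}\frac{\log\operatorname{Vol}B(o,r)}{r}$ (independent of $o$). *)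

theory Defs
  imports "HOL-Analysis.Analysis"
begin

text \<open>
  Hilbert geometry of a plane convex body \<open>K\<close> (compact, convex, non-empty interior). All the
  notions below are meant for such a \<open>K\<close> and for base points in \<open>interior K\<close>; under these
  conditions every ray from a base point meets \<open>frontier K\<close> exactly once, so that the definite
  descriptions are uniquely satisfied.
\<close>

definition boundary_beyond :: "(real^2) set \<Rightarrow> real^2 \<Rightarrow> real^2 \<Rightarrow> real^2" where
  "boundary_beyond K x y = (THE b. b \<in> frontier K \<and> y \<in> open_segment x b)"

definition hilbert_dist :: "(real^2) set \<Rightarrow> real^2 \<Rightarrow> real^2 \<Rightarrow> real" where
  "hilbert_dist K x y =
     (if x = y then 0
      else let a = boundary_beyond K y x; b = boundary_beyond K x y
           in 1/2 * ln ((dist a y * dist b x) / (dist a x * dist b y)))"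

definition exit_time :: "(real^2) set \<Rightarrow> real^2 \<Rightarrow> real^2 \<Rightarrow> real" where
  "exit_time K x v = (THE t. t > 0 \<and> x + t *\<^sub>R v \<in> frontier K)"

definition finsler_norm :: "(real^2) set \<Rightarrow> real^2 \<Rightarrow> real^2 \<Rightarrow> real" where
  "finsler_norm K x v =
     (if v = 0 then 0 else 1/2 * (1 / exit_time K x v + 1 / exit_time K x (- v)))"

definition busemann_density :: "(real^2) set \<Rightarrow> real^2 \<Rightarrow> real" where
  "busemann_density K x = pi / measure lebesgue {v. finsler_norm K x v \<le> 1}"

definition busemann_vol :: "(real^2) set \<Rightarrow> (real^2) set \<Rightarrow> ennreal" where
  "busemann_vol K A = (\<integral>\<^sup>+x\<in>A. ennreal (busemann_density K x) \<partial>lebesgue)"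

definition hilbert_ball :: "(real^2) set \<Rightarrow> real^2 \<Rightarrow> real \<Rightarrow> (real^2) set" where
  "hilbert_ball K p r = {x \<in> interior K. hilbert_dist K p x < r}"

text \<open>
  The balls are relatively compact in \<open>interior K\<close>, hence of finite volume, and of positive volume
  for \<open>r > 0\<close>; the conversion to a real number below therefore loses nothing.
\<close>

definition log_vol_rate :: "(real^2) set \<Rightarrow> real^2 \<Rightarrow> real \<Rightarrow> real" where
  "log_vol_rate K p r = ln (enn2real (busemann_vol K (hilbert_ball K p r))) / r"

definition upper_entropy :: "(real^2) set \<Rightarrow> real^2 \<Rightarrow> ereal" where
  "upper_entropy K p = Limsup at_top (\<lambda>r. ereal (log_vol_rate K p r))"

definition lower_entropy :: "(real^2) set \<Rightarrow> real^2 \<Rightarrow> ereal" where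
  "lower_entropy K p = Liminf at_top (\<lambda>r. ereal (log_vol_rate K p r))"

end

theory Submission
  imports Defs "HOL-Real_Asymp.Real_Asymp"
begin

text \<open>
Write \<open>\<epsilon> = exp (- 2 r)\<close>. Up to constants, the Hilbert ball of radius \<open>r\<close> about \<open>p\<close> consists of
  the points of \<open>K\<close> at Euclidean distance at least \<open>\<epsilon>\<close> from the boundary
  (\<open>hilbert_ball_imp_ball\<close>, \<open>ball_imp_hilbert_ball\<close>), so the entropy measures how fast the volume
  of \<open>K\<close> without an \<open>\<epsilon>\<close>-collar grows. The unit ball of the Finsler norm at \<open>x\<close> contains
  \<open>(K - x) \<inter> (x - K)\<close> and is contained in twice that set; a parallelogram inside it bounds the
  density from above, and a parallelogram around it bounds the density from below
  (\<open>busemann_density_le\<close>, \<open>busemann_density_ge\<close>). Each edge of \<open>K\<close> is then treated on its own.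

  Lower bound. An edge that spans an arc \<open>\<alpha>\<close> of the unit circle cuts off a cap of height of order
  \<open>\<alpha>\<^sup>2\<close>. At depth of order \<open>\<alpha>\<^sup>2\<close> below the edge the Finsler unit ball fits into a rectangle with
  sides of order \<open>\<alpha>\<^sup>2\<close> and \<open>\<alpha>\<close>, so the density is at least of order \<open>1 / \<alpha>\<^sup>3\<close> on a cell of area of
  order \<open>\<alpha>\<^sup>3\<close> (\<open>cap_density_ge\<close>, \<open>cap_cell_measure\<close>). Every edge with \<open>\<epsilon>\<close> small compared to \<open>\<alpha>\<^sup>2\<close>
  therefore contributes a fixed amount, and as the gap number \<open>j\<close> is at least \<open>C / (j+1)\<^sup>s\<close>, the
  number of such edges is of order \<open>exp (r / s)\<close>. This gives the bound \<open>1 / s\<close> (\<open>volume_growth_ge\<close>).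

  Upper bound. A point of the triangle with vertices \<open>0\<close>, \<open>A\<close>, \<open>B\<close> over an edge \<open>A B\<close> is
  \<open>x = p A + q B\<close>, and \<open>1 - (p + q)\<close> is its depth. Around \<open>x\<close> the body contains a parallelogram
  with half-diagonals proportional to \<open>1 - (p + q)\<close> across the edge and to \<open>min p q\<close> plus a multiple
  of \<open>1 - (p + q)\<close> along it. Cut the triangle into cells on which the depth and \<open>min p q\<close> are
  constant up to a factor 2: each cell has bounded volume, so the part at depth at least
  \<open>2\<^sup>-\<^sup>n\<close> has volume of order \<open>n\<^sup>2\<close>, however short the edge is (\<open>trunc_dominated\<close>). For very short
  edges the bound \<open>2\<^sup>n |A - B|\<close> is better (\<open>trunc_dominated_linear\<close>). With \<open>N\<close> of order
  \<open>exp (2 r / s)\<close>, the first \<open>3 N\<close> gaps are estimated by the first bound. The remaining ones have total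
  length of order \<open>N powr (1 - s)\<close> (\<open>limit_angle_gap\<close>) and the second bound gives
  \<open>exp (2 r) N powr (1 - s)\<close>, again of order \<open>exp (2 r / s)\<close> (\<open>volume_growth_le\<close>). Hence
  the upper entropy is at most \<open>2 / s\<close>, and \<open>2 / s \<le> (2 s - 2) / (3 s - 4)\<close> amounts to
  \<open>(s - 2)\<^sup>2 \<ge> 0\<close>.
\<close>

section \<open>Parallelograms\<close>

definition cross2 :: "real^2 \<Rightarrow> real^2 \<Rightarrow> real" where
  "cross2 a b = a$1 * b$2 - a$2 * b$1"

definition paral :: "real^2 \<Rightarrow> real^2 \<Rightarrow> real set \<Rightarrow> real set \<Rightarrow> (real^2) set" where
  "paral a b I J = {x *\<^sub>R a + y *\<^sub>R b | x y. x \<in> I \<and> y \<in> J}"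

lemma
  assumes "i \<le> i'" "j \<le> j'"
  shows paral_lmeasurable: "paral a b {i..i'} {j..j'} \<in> lmeasurable"
    and measure_paral: "measure lebesgue (paral a b {i..i'} {j..j'}) = \<bar>cross2 a b\<bar> * ((i'-i)*(j'-j))"
proof -
  define f :: "real^2 \<Rightarrow> real^2" where "f z = z$1 *\<^sub>R a + z$2 *\<^sub>R b" for z
  have lin: "linear f"
    unfolding f_def by (rule linearI) (simp_all add: algebra_simps)
  let ?B = "cbox (vector [i,j]) (vector [i',j']) :: (real^2) set"
  have "paral a b {i..i'} {j..j'} = f ` ?B"
  proof (intro set_eqI iffI)
    fix z assume "z \<in> paral a b {i..i'} {j..j'}"
    then obtain x y where "z = x *\<^sub>R a + y *\<^sub>R b" "x \<in> {i..i'}" "y \<in> {j..j'}"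
      unfolding paral_def by auto
    then show "z \<in> f ` ?B"
      by (intro image_eqI[of _ _ "vector [x,y]"]) (auto simp: f_def mem_box_cart forall_2)
  next
    fix z assume "z \<in> f ` ?B"
    then obtain w where w: "z = w$1 *\<^sub>R a + w$2 *\<^sub>R b" "w \<in> ?B" unfolding f_def by auto
    then show "z \<in> paral a b {i..i'} {j..j'}"
      unfolding paral_def
      by (intro CollectI exI[of _ "w$1"] exI[of _ "w$2"]) (auto simp: mem_box_cart forall_2)
  qed
  moreover have "det (matrix f) = cross2 a b"
    by (simp add: matrix_def f_def det_2 cross2_def axis_def)
  moreover have "measure lebesgue ?B = (i'-i)*(j'-j)"
  proof -
    have "vector [i,j] \<in> ?B" using assms by (auto simp: mem_box_cart forall_2)
    then have "?B \<noteq> {}" by blast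
    then show ?thesis by (simp add: content_cbox_cart prod_2 UNIV_2)
  qed
  moreover have "?B \<in> lmeasurable" by simp
  ultimately show "paral a b {i..i'} {j..j'} \<in> lmeasurable"
    "measure lebesgue (paral a b {i..i'} {j..j'}) = \<bar>cross2 a b\<bar> * ((i'-i)*(j'-j))"
    using measurable_linear_image[OF lin, of ?B] measure_linear_image[OF lin, of ?B] by auto
qed

section \<open>Rays from an interior point\<close>

text \<open>
  The open segment from an interior point of a convex set to a point of its closure lies in the
  interior, so no ray can meet the frontier twice.
\<close>

lemma ray_exit_unique:
  fixes x v :: "real^2"
  assumes K: "compact K" "convex K" "x \<in> interior K" and v: "v \<noteq> 0"
  shows "\<exists>!t. t > 0 \<and> x + t *\<^sub>R v \<in> frontier K"
proof -
  have bd: "bounded K" using K compact_imp_bounded by auto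
  obtain d where d: "0 < d" "x + d *\<^sub>R v \<in> frontier K"
    using ray_to_frontier[OF bd K(3) v] by metis
  have aux: False if "0 < t" "t < u" "x + t *\<^sub>R v \<in> frontier K" "x + u *\<^sub>R v \<in> frontier K" for t u
  proof -
    have "x + t *\<^sub>R v \<in> open_segment x (x + u *\<^sub>R v)"
      unfolding in_segment using that v
      by (intro conjI exI[of _ "t/u"]) (auto simp: algebra_simps)
    moreover have "open_segment x (x + u *\<^sub>R v) \<subseteq> interior K"
      using in_interior_closure_convex_segment K that frontier_def by blast
    ultimately show False using that unfolding frontier_def by auto
  qed
  show ?thesis
  proof (rule ex1I[of _ d])
    show "u = d" if "u > 0 \<and> x + u *\<^sub>R v \<in> frontier K" for u
      using aux[of u d] aux[of d u] that d by (meson linorder_neqE_linordered_idom)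
  qed (use d in auto)
qed

lemma
  assumes K: "compact K" "convex K" "x \<in> interior K" and v: "v \<noteq> 0"
  shows exit_time_pos: "exit_time K x v > 0"
    and exit_time_frontier: "x + exit_time K x v *\<^sub>R v \<in> frontier K"
  using theI'[OF ray_exit_unique[OF assms]] unfolding exit_time_def by auto

lemma exit_time_mem_iff:
  assumes K: "compact K" "convex K" "x \<in> interior K" and v: "v \<noteq> 0" and t: "0 \<le> t"
  shows "x + t *\<^sub>R v \<in> K \<longleftrightarrow> t \<le> exit_time K x v"
proof
  let ?u = "exit_time K x v"
  assume a: "x + t *\<^sub>R v \<in> K"
  show "t \<le> ?u"
  proof (rule ccontr)
    assume "\<not> t \<le> ?u"
    then have "x + ?u *\<^sub>R v \<in> open_segment x (x + t *\<^sub>R v)"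
      unfolding in_segment using v exit_time_pos[OF K v]
      by (intro conjI exI[of _ "?u/t"]) (auto simp: algebra_simps)
    moreover have "open_segment x (x + t *\<^sub>R v) \<subseteq> interior K"
      using in_interior_closure_convex_segment K a closure_subset by blast
    ultimately show False using exit_time_frontier[OF K v] unfolding frontier_def by auto
  qed
next
  let ?u = "exit_time K x v"
  assume a: "t \<le> ?u"
  have u: "?u > 0" using exit_time_pos[OF K v] .
  have "x + ?u *\<^sub>R v \<in> K"
    using exit_time_frontier[OF K v] K(1) compact_imp_closed frontier_subset_closed by blast
  moreover have "x \<in> K" using K interior_subset by auto
  ultimately have "(1 - t/?u) *\<^sub>R x + (t/?u) *\<^sub>R (x + ?u *\<^sub>R v) \<in> K"
    using a u t K(2) by (intro convexD) auto
  then show "x + t *\<^sub>R v \<in> K" using u by (simp add: algebra_simps)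
qed

lemma boundary_beyond_props:
  assumes K: "compact K" "convex K" "x \<in> interior K" "y \<in> interior K" and "x \<noteq> y"
  shows "boundary_beyond K x y \<in> frontier K \<and> y \<in> open_segment x (boundary_beyond K x y)"
proof -
  have v: "y - x \<noteq> 0" using assms by auto
  let ?u = "exit_time K x (y - x)"
  note K3 = K(1-3)
  have u: "?u > 0" "x + ?u *\<^sub>R (y - x) \<in> frontier K"
    using exit_time_pos[OF K3 v] exit_time_frontier[OF K3 v] by auto
  have "1 \<le> ?u" using exit_time_mem_iff[OF K3 v, of 1] K interior_subset by auto
  moreover have "?u \<noteq> 1" using u(2) K(4) unfolding frontier_def by auto
  ultimately have u1: "1 < ?u" by auto
  show ?thesis unfolding boundary_beyond_def
  proof (rule theI)
    show "x + ?u *\<^sub>R (y - x) \<in> frontier K \<and> y \<in> open_segment x (x + ?u *\<^sub>R (y - x))"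
      unfolding in_segment using u u1 v
      by (intro conjI exI[of _ "1/?u"]) (auto simp: algebra_simps)
  next
    fix b assume b: "b \<in> frontier K \<and> y \<in> open_segment x b"
    then obtain w where w: "0 < w" "w < 1" "y = (1 - w) *\<^sub>R x + w *\<^sub>R b"
      unfolding in_segment by auto
    have b': "b = x + (1/w) *\<^sub>R (y - x)" unfolding w(3) using w by (simp add: algebra_simps)
    then have "1/w > 0 \<and> x + (1/w) *\<^sub>R (y - x) \<in> frontier K" using b w by auto
    then have "1/w = ?u" using ray_exit_unique[OF K3 v] u by blast
    then show "b = x + ?u *\<^sub>R (y - x)" using b' by simp
  qed
qed

section \<open>Hilbert balls and Euclidean distance to the boundary\<close>

text \<open>
  If \<open>b\<close> is the boundary point beyond \<open>x\<close> and \<open>x = (1 - w) p + w b\<close>, the distance bound gives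
  \<open>1 - w \<ge> exp (- 2 r)\<close>, and the homothety with centre \<open>b\<close> and ratio \<open>1 - w\<close> maps the ball about
  \<open>p\<close> to a ball about \<open>x\<close> inside \<open>K\<close>.
\<close>

lemma hilbert_ball_imp_ball:
  assumes K: "compact K" "convex K" and \<rho>: "0 < \<rho>" "ball p \<rho> \<subseteq> K" and r: "0 < r"
    and x: "x \<in> hilbert_ball K p r"
  shows "ball x (\<rho> * exp (- 2 * r)) \<subseteq> K"
proof (cases "x = p")
  case True
  have "\<rho> * exp (- 2 * r) \<le> \<rho>" using \<rho> r by simp
  then show ?thesis using \<rho>(2) True by (meson subset_ball order_trans)
next
  case False
  have p: "p \<in> interior K" using \<rho> by (meson centre_in_ball interior_maximal open_ball subsetD)
  have xi: "x \<in> interior K" and hd: "hilbert_dist K p x < r"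
    using x unfolding hilbert_ball_def by auto
  define a where "a = boundary_beyond K x p"
  define b where "b = boundary_beyond K p x"
  have a: "a \<in> frontier K" "p \<in> open_segment x a"
    using boundary_beyond_props[OF K xi p False] a_def by auto
  have b: "b \<in> frontier K" "x \<in> open_segment p b"
    using boundary_beyond_props[OF K p xi] False b_def by auto
  obtain w where w: "0 < w" "w < 1" "x = (1 - w) *\<^sub>R p + w *\<^sub>R b" "p \<noteq> b"
    using b(2) unfolding in_segment by auto
  have bK: "b \<in> K" using b K compact_imp_closed frontier_subset_closed by blast
  have ap: "dist a p \<le> dist a x" "dist a p > 0"
    using a(2) dist_in_open_segment[of p x a] open_segment_commute
    by (auto simp: dist_commute less_le)
  have bx: "dist b x = (1-w) * dist b p"
  proof -
    have "b - x = (1-w) *\<^sub>R (b - p)" using w by (simp add: algebra_simps)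
    then show ?thesis using w by (simp add: dist_norm)
  qed
  have bp: "dist b p > 0" using w by auto
  have "1/2 * ln ((dist a x * dist b p) / (dist a p * dist b x)) < r"
    using hd False unfolding hilbert_dist_def by (simp add: Let_def a_def b_def)
  then have "ln ((dist a x * dist b p) / (dist a p * dist b x)) < ln (exp (2*r))" by simp
  moreover have "(dist a x * dist b p) / (dist a p * dist b x) > 0"
    using ap bp bx w by (intro divide_pos_pos mult_pos_pos) auto
  ultimately have "(dist a x * dist b p) / (dist a p * dist b x) < exp (2*r)"
    by (subst (asm) ln_less_cancel_iff) auto
  moreover have "dist b p / dist b x \<le> (dist a x * dist b p) / (dist a p * dist b x)"
  proof -
    have "dist b p / dist b x = (dist a p * dist b p) / (dist a p * dist b x)" using ap(2) by simp
    also have "\<dots> \<le> (dist a x * dist b p) / (dist a p * dist b x)"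
      using ap by (intro divide_right_mono mult_right_mono) auto
    finally show ?thesis .
  qed
  moreover have "dist b p / dist b x = 1 / (1-w)" using bx bp by simp
  ultimately have "1/(1-w) < exp (2*r)" by linarith
  then have w2: "exp (-2*r) \<le> 1-w" using w by (simp add: field_simps exp_minus)
  show ?thesis
  proof
    fix z assume z: "z \<in> ball x (\<rho> * exp (- 2 * r))"
    define y where "y = p + (1/(1-w)) *\<^sub>R (z - x)"
    have "dist p y = norm (z - x) / (1-w)" using w by (simp add: y_def dist_norm)
    also have "\<dots> < \<rho>"
    proof -
      have "norm (z - x) < \<rho> * exp (-2*r)" using z by (simp add: dist_norm norm_minus_commute)
      also have "\<dots> \<le> \<rho> * (1-w)" using w2 \<rho> by simp
      finally show ?thesis using w by (simp add: pos_divide_less_eq)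
    qed
    finally have "y \<in> K" using \<rho> by auto
    then have "(1-w) *\<^sub>R y + w *\<^sub>R b \<in> K" using bK K w by (intro convexD) auto
    moreover have "(1-w) *\<^sub>R y = (1-w) *\<^sub>R p + (z - x)"
      unfolding y_def using w(1,2) by (simp add: scaleR_add_right)
    then have "(1-w) *\<^sub>R y + w *\<^sub>R b = z" using w(3) by simp
    ultimately show "z \<in> K" by simp
  qed
qed

text \<open>
  In the cross ratio, the two distances in the numerator are at most the diameter 2, and the two in
  the denominator are at least the radii of the given balls; hence the constant 4.
\<close>

lemma ball_imp_hilbert_ball:
  assumes K: "compact K" "convex K" "K \<subseteq> cball 0 1" and \<rho>: "0 < \<rho>" "ball p \<rho> \<subseteq> K"
    and r: "0 < r" and x: "ball x \<delta> \<subseteq> K" and \<delta>: "4 * exp (-2*r) < \<rho> * \<delta>"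
  shows "x \<in> hilbert_ball K p r"
proof -
  have \<delta>0: "\<delta> > 0"
    by (rule ccontr) (use \<delta> \<rho> in \<open>auto simp: not_less mult_le_0_iff dest: order_less_le_trans[of _ _ 0]\<close>)
  have p: "p \<in> interior K" using \<rho> by (meson centre_in_ball interior_maximal open_ball subsetD)
  have xi: "x \<in> interior K" using x \<delta>0 by (meson centre_in_ball interior_maximal open_ball subsetD)
  have "hilbert_dist K p x < r"
  proof (cases "p = x")
    case True then show ?thesis using r by (simp add: hilbert_dist_def)
  next
    case False
    define a where "a = boundary_beyond K x p"
    define b where "b = boundary_beyond K p x"
    have a: "a \<in> frontier K" "p \<in> open_segment x a"
      using boundary_beyond_props[OF K(1,2) xi p] False a_def by auto
    have b: "b \<in> frontier K" "x \<in> open_segment p b"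
      using boundary_beyond_props[OF K(1,2) p xi] False b_def by auto
    have far: "dist c z \<ge> e" if "c \<in> frontier K" "ball z e \<subseteq> K" for c z e
    proof (rule ccontr)
      assume "\<not> ?thesis"
      then have "c \<in> ball z e" by (simp add: dist_commute)
      then have "c \<in> interior K" using that by (meson interior_maximal open_ball subsetD)
      then show False using that unfolding frontier_def by auto
    qed
    have diam: "dist y z \<le> 2" if "y \<in> K" "z \<in> K" for y z
    proof -
      have "norm y \<le> 1" "norm z \<le> 1" using that K(3) by auto
      then show ?thesis using norm_triangle_ineq4[of y z] by (simp add: dist_norm)
    qed
    have mem: "a \<in> K" "b \<in> K" "x \<in> K" "p \<in> K"
      using a b xi p K compact_imp_closed frontier_subset_closed interior_subset by blast+
    have "dist a x * dist b p \<le> 2 * 2" using diam mem by (intro mult_mono) auto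
    also have "\<dots> < exp (2*r) * (\<rho> * \<delta>)" using \<delta> by (simp add: field_simps exp_minus)
    also have "\<dots> \<le> exp (2*r) * (dist a p * dist b x)"
      using far[OF a(1) \<rho>(2)] far[OF b(1) x] \<rho> \<delta>0 by (intro mult_left_mono mult_mono) auto
    finally have *: "dist a x * dist b p < exp (2*r) * (dist a p * dist b x)" .
    have pos: "dist a p > 0" "dist b x > 0" using far[OF a(1) \<rho>(2)] far[OF b(1) x] \<rho> \<delta>0 by auto
    have pos': "dist a x > 0" "dist b p > 0" using a(2) b(2) by (auto simp: open_segment_def)
    have "(dist a x * dist b p) / (dist a p * dist b x) < exp (2*r)"
      using * pos by (simp add: divide_less_eq)
    then have "ln ((dist a x * dist b p) / (dist a p * dist b x)) < ln (exp (2*r))"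
      using pos pos' by (subst ln_less_cancel_iff) auto
    then show ?thesis using False unfolding hilbert_dist_def by (simp add: Let_def a_def b_def)
  qed
  then show ?thesis using xi unfolding hilbert_ball_def by auto
qed

section \<open>The Busemann density\<close>

text \<open>
  The norm of \<open>v\<close> is the mean of \<open>1 / t\<^sub>1\<close> and \<open>1 / t\<^sub>2\<close>, which lies between half of their maximum
  and their maximum.
\<close>

lemma finsler_unit_ball_bounds:
  assumes K: "compact K" "convex K" "x \<in> interior K"
  shows "x + v \<in> K \<Longrightarrow> x - v \<in> K \<Longrightarrow> finsler_norm K x v \<le> 1"
    and "finsler_norm K x v \<le> 1 \<Longrightarrow> x + (1/2) *\<^sub>R v \<in> K \<and> x - (1/2) *\<^sub>R v \<in> K"
proof -
  have "finsler_norm K x v \<le> 1" if "x + v \<in> K" "x - v \<in> K" "v \<noteq> 0"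
  proof -
    have "1 \<le> exit_time K x v" "1 \<le> exit_time K x (-v)"
      using exit_time_mem_iff[OF K, of v 1] exit_time_mem_iff[OF K, of "-v" 1] that by auto
    then have "1 / exit_time K x v \<le> 1" "1 / exit_time K x (-v) \<le> 1" by auto
    then show ?thesis unfolding finsler_norm_def by auto
  qed
  then show "x + v \<in> K \<Longrightarrow> x - v \<in> K \<Longrightarrow> finsler_norm K x v \<le> 1"
    by (cases "v = 0") (auto simp: finsler_norm_def)
  show "x + (1/2) *\<^sub>R v \<in> K \<and> x - (1/2) *\<^sub>R v \<in> K" if F: "finsler_norm K x v \<le> 1"
  proof (cases "v = 0")
    case True then show ?thesis using K interior_subset by auto
  next
    case False
    have pos: "exit_time K x v > 0" "exit_time K x (-v) > 0"
      using exit_time_pos[OF K] False by auto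
    then have "1 / exit_time K x v > 0" "1 / exit_time K x (-v) > 0" by auto
    moreover have "1 / exit_time K x v + 1 / exit_time K x (-v) \<le> 2"
      using F False unfolding finsler_norm_def by auto
    ultimately have "1 / exit_time K x v \<le> 2" "1 / exit_time K x (-v) \<le> 2" by linarith+
    then have "1/2 \<le> exit_time K x v" "1/2 \<le> exit_time K x (-v)"
      using pos by (auto simp: field_simps)
    then show ?thesis
      using exit_time_mem_iff[OF K, of v "1/2"] exit_time_mem_iff[OF K, of "-v" "1/2"] False by auto
  qed
qed

lemma exit_time_scaleR:
  assumes K: "compact K" "convex K" "x \<in> interior K" and v: "v \<noteq> 0" and c: "c > 0"
  shows "exit_time K x (c *\<^sub>R v) = exit_time K x v / c"
proof -
  have cv: "c *\<^sub>R v \<noteq> 0" using v c by auto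
  have "exit_time K x v / c > 0 \<and> x + (exit_time K x v / c) *\<^sub>R c *\<^sub>R v \<in> frontier K"
    using exit_time_pos[OF K v] exit_time_frontier[OF K v] c by auto
  then show ?thesis
    using ray_exit_unique[OF K cv] exit_time_pos[OF K cv] exit_time_frontier[OF K cv] by blast
qed

lemma finsler_norm_scaleR:
  assumes K: "compact K" "convex K" "x \<in> interior K" and c: "c \<ge> 0"
  shows "finsler_norm K x (c *\<^sub>R v) = c * finsler_norm K x v"
proof (cases "v = 0 \<or> c = 0")
  case True then show ?thesis by (auto simp: finsler_norm_def)
next
  case False
  then have "c > 0" "v \<noteq> 0" "-v \<noteq> 0" using c by auto
  then show ?thesis
    using exit_time_scaleR[OF K, of v c] exit_time_scaleR[OF K, of "-v" c]
    by (simp add: finsler_norm_def algebra_simps)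
qed

text \<open>
  The reciprocal exit time is the gauge of \<open>K - x\<close>; its triangle inequality is the convexity of \<open>K\<close>
  applied to the two exit points, with weights chosen so that the velocities add up.
\<close>

lemma inverse_exit_time_subadd:
  assumes K: "compact K" "convex K" "x \<in> interior K" and v: "v \<noteq> 0" "w \<noteq> 0" "v + w \<noteq> 0"
  shows "1 / exit_time K x (v + w) \<le> 1 / exit_time K x v + 1 / exit_time K x w"
proof -
  define s where "s = exit_time K x v"
  define t where "t = exit_time K x w"
  have st: "s > 0" "t > 0" using exit_time_pos[OF K] v by (auto simp: s_def t_def)
  have "x + s *\<^sub>R v \<in> K" "x + t *\<^sub>R w \<in> K"
    using exit_time_mem_iff[OF K v(1), of s] exit_time_mem_iff[OF K v(2), of t] st
    by (auto simp: s_def t_def)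
  then have "(t/(s+t)) *\<^sub>R (x + s *\<^sub>R v) + (s/(s+t)) *\<^sub>R (x + t *\<^sub>R w) \<in> K"
    using st K(2) by (intro convexD) (auto simp: add_divide_distrib[symmetric] add.commute)
  also have "(t/(s+t)) *\<^sub>R (x + s *\<^sub>R v) + (s/(s+t)) *\<^sub>R (x + t *\<^sub>R w)
      = (t/(s+t) + s/(s+t)) *\<^sub>R x + (s*t/(s+t)) *\<^sub>R (v + w)"
    by (simp add: algebra_simps)
  also have "t/(s+t) + s/(s+t) = 1" using st by (simp add: add_divide_distrib[symmetric] add.commute)
  finally have "s*t/(s+t) \<le> exit_time K x (v + w)"
    using exit_time_mem_iff[OF K v(3), of "s*t/(s+t)"] st by simp
  then have "1 / exit_time K x (v + w) \<le> 1 / (s*t/(s+t))"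
    using st exit_time_pos[OF K v(3)] by (intro divide_left_mono) auto
  also have "\<dots> = 1/s + 1/t" using st by (simp add: field_simps)
  finally show ?thesis by (simp add: s_def t_def)
qed

lemma finsler_norm_triangle:
  assumes K: "compact K" "convex K" "x \<in> interior K"
  shows "finsler_norm K x (v + w) \<le> finsler_norm K x v + finsler_norm K x w"
proof -
  have nn: "finsler_norm K x u \<ge> 0" for u
    using exit_time_pos[OF K, of u] exit_time_pos[OF K, of "-u"]
    by (cases "u = 0") (auto simp: finsler_norm_def)
  consider "v = 0" | "w = 0" | "v + w = 0" | "v \<noteq> 0" "w \<noteq> 0" "v + w \<noteq> 0" by auto
  then show ?thesis
  proof cases
    case 3 then show ?thesis using nn[of v] nn[of w] by (simp add: finsler_norm_def)
  next
    case 4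
    then have "- v \<noteq> 0" "- w \<noteq> 0" "- v + - w \<noteq> 0" by (auto simp: add_eq_0_iff2)
    then show ?thesis using inverse_exit_time_subadd[OF K 4] inverse_exit_time_subadd[OF K, of "-v" "-w"] 4
      by (simp add: finsler_norm_def add_divide_distrib)
  qed (auto simp: finsler_norm_def)
qed

text \<open>
  On a non-measurable set \<open>measure\<close> is 0, which would make the density 0; the lower bound for the
  density rests on this lemma.
\<close>

lemma finsler_unit_ball_lmeasurable:
  assumes K: "compact K" "convex K" "x \<in> interior K"
  shows "{v. finsler_norm K x v \<le> 1} \<in> lmeasurable"
proof (rule measurable_convex)
  show "convex {v. finsler_norm K x v \<le> 1}"
  proof (rule convexI)
    fix v w :: "real^2" and a b :: real
    assume *: "v \<in> {v. finsler_norm K x v \<le> 1}" "w \<in> {v. finsler_norm K x v \<le> 1}"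
      "0 \<le> a" "0 \<le> b" "a + b = 1"
    have "finsler_norm K x (a *\<^sub>R v + b *\<^sub>R w) \<le> a * finsler_norm K x v + b * finsler_norm K x w"
      using finsler_norm_triangle[OF K, of "a *\<^sub>R v" "b *\<^sub>R w"] finsler_norm_scaleR[OF K] * by simp
    also have "\<dots> \<le> a * 1 + b * 1" using * by (intro add_mono mult_left_mono) auto
    finally show "a *\<^sub>R v + b *\<^sub>R w \<in> {v. finsler_norm K x v \<le> 1}" using * by simp
  qed
  have "bounded ((\<lambda>y. 2 *\<^sub>R (y - x)) ` K)"
    using compact_imp_bounded[OF K(1)]
    by (intro bounded_linear_image[of "(\<lambda>y. y - x) ` K" "(*\<^sub>R) 2", unfolded image_image] bounded_translation_minus bounded_linear_scaleR_right)
  moreover have "{v. finsler_norm K x v \<le> 1} \<subseteq> (\<lambda>y. 2 *\<^sub>R (y - x)) ` K"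
  proof
    fix v assume "v \<in> {v. finsler_norm K x v \<le> 1}"
    then have "x + (1/2) *\<^sub>R v \<in> K" using finsler_unit_ball_bounds(2)[OF K] by auto
    then show "v \<in> (\<lambda>y. 2 *\<^sub>R (y - x)) ` K" by (intro image_eqI) auto
  qed
  ultimately show "bounded {v. finsler_norm K x v \<le> 1}" using bounded_subset by blast
qed

text \<open>
  The parallelogram \<open>l p + m q\<close> with \<open>\<bar>l\<bar>, \<bar>m\<bar> \<le> 1/2\<close> is inscribed in the rhombus with vertices \<open>\<plusminus> p\<close>,
  \<open>\<plusminus> q\<close>, hence in the Finsler unit ball.
\<close>

lemma busemann_density_le:
  assumes K: "compact K" "convex K" "x \<in> interior K"
    and p: "x + p \<in> K" "x - p \<in> K" and q: "x + q \<in> K" "x - q \<in> K" and c: "cross2 p q \<noteq> 0"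
  shows "busemann_density K x \<le> pi / \<bar>cross2 p q\<bar>"
proof -
  let ?P = "paral p q {-(1/2)..1/2} {-(1/2)..1/2}"
  have sym: "x + v \<in> K" if "v \<in> ?P" for v
  proof -
    obtain l m where lm: "v = l *\<^sub>R p + m *\<^sub>R q" "\<bar>l\<bar> \<le> 1/2" "\<bar>m\<bar> \<le> 1/2"
      using \<open>v \<in> ?P\<close> unfolding paral_def by (auto simp: abs_le_iff)
    have *: "x + (2*k) *\<^sub>R y \<in> K" if "x + y \<in> K" "x - y \<in> K" "\<bar>k\<bar> \<le> 1/2" for y k
    proof -
      have "(1/2 + k) *\<^sub>R (x + y) + (1/2 - k) *\<^sub>R (x - y) \<in> K"
        using that K(2) by (intro convexD) (auto simp: abs_le_iff)
      moreover have "(1/2 + k) *\<^sub>R (x + y) + (1/2 - k) *\<^sub>R (x - y) = x + (2*k) *\<^sub>R y"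
        by (simp add: vec_eq_iff algebra_simps)
      ultimately show ?thesis by simp
    qed
    have "(1/2) *\<^sub>R (x + (2*l) *\<^sub>R p) + (1/2) *\<^sub>R (x + (2*m) *\<^sub>R q) \<in> K"
      using *[OF p lm(2)] *[OF q lm(3)] K(2) by (intro convexD) auto
    moreover have "(1/2) *\<^sub>R (x + (2*l) *\<^sub>R p) + (1/2) *\<^sub>R (x + (2*m) *\<^sub>R q) = x + v"
      unfolding lm(1) by (simp add: vec_eq_iff algebra_simps)
    ultimately show ?thesis by simp
  qed
  have neg: "- v \<in> ?P" if "v \<in> ?P" for v
  proof -
    obtain l m where "v = l *\<^sub>R p + m *\<^sub>R q" "l \<in> {-(1/2)..1/2}" "m \<in> {-(1/2)..1/2}"
      using \<open>v \<in> ?P\<close> unfolding paral_def by auto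
    then show ?thesis unfolding paral_def
      by (intro CollectI exI[of _ "-l"] exI[of _ "-m"]) auto
  qed
  have "?P \<subseteq> {v. finsler_norm K x v \<le> 1}"
    using finsler_unit_ball_bounds(1)[OF K] sym neg by force
  then have "measure lebesgue ?P \<le> measure lebesgue {v. finsler_norm K x v \<le> 1}"
    by (intro measure_mono_fmeasurable finsler_unit_ball_lmeasurable[OF K] fmeasurableD paral_lmeasurable) auto
  moreover have "measure lebesgue ?P = \<bar>cross2 p q\<bar>" by (subst measure_paral) auto
  ultimately show ?thesis unfolding busemann_density_def using c
    by (intro divide_left_mono mult_pos_pos) auto
qed

text \<open>
  The Finsler unit ball lies in the doubled parallelogram. It also contains a Euclidean ball, so its
  measure is not 0 and the quotient defining the density is genuine.
\<close>

lemma busemann_density_ge: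
  assumes K: "compact K" "convex K" "x \<in> interior K"
    and sub: "\<And>v. x + v \<in> K \<Longrightarrow> x - v \<in> K \<Longrightarrow> v \<in> paral a b {-i..i} {-j..j}"
    and ij: "0 \<le> i" "0 \<le> j"
  shows "busemann_density K x \<ge> pi / (16 * i * j * \<bar>cross2 a b\<bar>)"
proof -
  let ?B = "{v. finsler_norm K x v \<le> 1}"
  let ?P = "paral a b {-(2*i)..2*i} {-(2*j)..2*j}"
  have "?B \<subseteq> ?P"
  proof
    fix v assume "v \<in> ?B"
    then have "(1/2) *\<^sub>R v \<in> paral a b {-i..i} {-j..j}"
      using finsler_unit_ball_bounds(2)[OF K] sub by auto
    then obtain l m where lm: "(1/2) *\<^sub>R v = l *\<^sub>R a + m *\<^sub>R b" "l \<in> {-i..i}" "m \<in> {-j..j}"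
      unfolding paral_def by auto
    have "v = 2 *\<^sub>R ((1/2) *\<^sub>R v)" by simp
    also have "\<dots> = (2*l) *\<^sub>R a + (2*m) *\<^sub>R b" unfolding lm(1) by (simp add: algebra_simps)
    finally show "v \<in> ?P" using lm unfolding paral_def
      by (intro CollectI exI[of _ "2*l"] exI[of _ "2*m"]) auto
  qed
  then have "measure lebesgue ?B \<le> measure lebesgue ?P"
    using finsler_unit_ball_lmeasurable[OF K] ij
    by (intro measure_mono_fmeasurable paral_lmeasurable fmeasurableD) auto
  also have "\<dots> = 16 * i * j * \<bar>cross2 a b\<bar>" using ij by (subst measure_paral) auto
  finally have 1: "measure lebesgue ?B \<le> 16 * i * j * \<bar>cross2 a b\<bar>" .
  obtain e where e: "0 < e" "ball x e \<subseteq> K" using K(3) mem_interior by blast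
  have "ball 0 e \<subseteq> ?B"
  proof
    fix v assume "v \<in> ball (0::real^2) e"
    then have "x + v \<in> ball x e" "x - v \<in> ball x e" by (auto simp: dist_norm)
    then show "v \<in> ?B" using e finsler_unit_ball_bounds(1)[OF K] by blast
  qed
  then have "measure lebesgue (ball (0::real^2) e) \<le> measure lebesgue ?B"
    by (intro measure_mono_fmeasurable finsler_unit_ball_lmeasurable[OF K]) auto
  moreover have "measure lebesgue (ball (0::real^2) e) > 0"
    using e content_ball_pos[of e 0] by auto
  ultimately have 2: "measure lebesgue ?B > 0" by linarith
  show ?thesis unfolding busemann_density_def using 1 2
    by (intro divide_left_mono mult_pos_pos[OF 2] less_le_trans[OF 2 1]) auto
qed

section \<open>Bounds for the Busemann volume of a set\<close>

text \<open>
  Domination by a measurable majorant: unlike the lower integral of a possibly non-measurable density,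
  this kind of bound is countably subadditive.
\<close>

definition dominated :: "(real^2) set \<Rightarrow> (real^2) set \<Rightarrow> ennreal \<Rightarrow> bool" where
  "dominated K A c \<longleftrightarrow> (\<exists>G \<in> borel_measurable lebesgue.
     (\<forall>x\<in>A. ennreal (busemann_density K x) \<le> G x) \<and> (\<integral>\<^sup>+x. G x \<partial>lebesgue) \<le> c)"

lemma dominated_imp_vol_le: "dominated K A c \<Longrightarrow> busemann_vol K A \<le> c"
  unfolding dominated_def busemann_vol_def
  by (elim bexE conjE order_trans[rotated], intro nn_integral_mono) (auto split: split_indicator)

lemma dominated_mono: "dominated K B c \<Longrightarrow> A \<subseteq> B \<Longrightarrow> c \<le> d \<Longrightarrow> dominated K A d"
  unfolding dominated_def by (meson order_trans subsetD)

lemma dominated_UN: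
  assumes "\<And>i::nat. dominated K (A i) (c i)"
  shows "dominated K (\<Union>i. A i) (\<Sum>i. c i)"
proof -
  obtain G where G: "\<And>i. G i \<in> borel_measurable lebesgue"
    "\<And>i x. x \<in> A i \<Longrightarrow> ennreal (busemann_density K x) \<le> G i x"
    "\<And>i. (\<integral>\<^sup>+x. G i x \<partial>lebesgue) \<le> c i"
    using assms unfolding dominated_def by metis
  show ?thesis unfolding dominated_def
  proof (intro bexI[of _ "\<lambda>x. \<Sum>i. G i x"] conjI ballI)
    fix x assume "x \<in> (\<Union>i. A i)"
    then obtain i where "x \<in> A i" by auto
    then have "ennreal (busemann_density K x) \<le> G i x" using G by auto
    also have "\<dots> \<le> (\<Sum>i. G i x)"
      using sum_le_suminf[of "\<lambda>i. G i x" "{i}"] by simp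
    finally show "ennreal (busemann_density K x) \<le> (\<Sum>i. G i x)" .
  next
    have "(\<integral>\<^sup>+x. (\<Sum>i. G i x) \<partial>lebesgue) = (\<Sum>i. \<integral>\<^sup>+x. G i x \<partial>lebesgue)"
      using G by (intro nn_integral_suminf) auto
    also have "\<dots> \<le> (\<Sum>i. c i)" using G by (intro suminf_le) auto
    finally show "(\<integral>\<^sup>+x. (\<Sum>i. G i x) \<partial>lebesgue) \<le> (\<Sum>i. c i)" .
  qed (use G in measurable)
qed

lemma dominated_finite_UN:
  assumes "finite I" "\<And>i. i \<in> I \<Longrightarrow> dominated K (A i) (c i)"
  shows "dominated K (\<Union>i\<in>I. A i) (\<Sum>i\<in>I. c i)"
proof -
  obtain G where G: "\<And>i. i \<in> I \<Longrightarrow> G i \<in> borel_measurable lebesgue"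
    "\<And>i x. i \<in> I \<Longrightarrow> x \<in> A i \<Longrightarrow> ennreal (busemann_density K x) \<le> G i x"
    "\<And>i. i \<in> I \<Longrightarrow> (\<integral>\<^sup>+x. G i x \<partial>lebesgue) \<le> c i"
    using assms(2) unfolding dominated_def by metis
  show ?thesis unfolding dominated_def
  proof (intro bexI[of _ "\<lambda>x. \<Sum>i\<in>I. G i x"] conjI ballI)
    fix x assume "x \<in> (\<Union>i\<in>I. A i)"
    then obtain i where i: "i \<in> I" "x \<in> A i" by auto
    then have "ennreal (busemann_density K x) \<le> G i x" using G by auto
    also have "\<dots> \<le> (\<Sum>i\<in>I. G i x)" using assms(1) i by (intro member_le_sum) auto
    finally show "ennreal (busemann_density K x) \<le> (\<Sum>i\<in>I. G i x)" .
  next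
    have "(\<integral>\<^sup>+x. (\<Sum>i\<in>I. G i x) \<partial>lebesgue) = (\<Sum>i\<in>I. \<integral>\<^sup>+x. G i x \<partial>lebesgue)"
      using G by (intro nn_integral_sum) auto
    also have "\<dots> \<le> (\<Sum>i\<in>I. c i)" using G by (intro sum_mono) auto
    finally show "(\<integral>\<^sup>+x. (\<Sum>i\<in>I. G i x) \<partial>lebesgue) \<le> (\<Sum>i\<in>I. c i)" .
  qed (use G in measurable)
qed

lemma dominated_Un:
  assumes "dominated K A c" "dominated K B d"
  shows "dominated K (A \<union> B) (c + d)"
proof -
  have "dominated K (\<Union>i\<in>{True,False}. if i then A else B) (\<Sum>i\<in>{True,False}. if i then c else d)"
    using assms by (intro dominated_finite_UN) auto
  then show ?thesis by (simp add: Un_commute add.commute)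
qed

lemma dominated_const:
  assumes "P \<in> lmeasurable" "A \<subseteq> P" "\<And>x. x \<in> A \<Longrightarrow> busemann_density K x \<le> M" "0 \<le> M"
  shows "dominated K A (ennreal (M * measure lebesgue P))"
  unfolding dominated_def
proof (intro bexI[of _ "\<lambda>x. ennreal M * indicator P x"] conjI ballI)
  show "ennreal (busemann_density K x) \<le> ennreal M * indicator P x" if "x \<in> A" for x
    using that assms by (auto intro!: ennreal_leI)
  have "(\<integral>\<^sup>+x. ennreal M * indicator P x \<partial>lebesgue) = ennreal M * emeasure lebesgue P"
    using assms(1) by (intro nn_integral_cmult_indicator) auto
  also have "\<dots> = ennreal (M * measure lebesgue P)"
    using assms by (simp add: emeasure_eq_measure2 ennreal_mult)
  finally show "(\<integral>\<^sup>+x. ennreal M * indicator P x \<partial>lebesgue) \<le> ennreal (M * measure lebesgue P)" by simp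
  have "P \<in> sets lebesgue" using assms(1) by auto
  then show "(\<lambda>x. ennreal M * indicator P x) \<in> borel_measurable lebesgue" by measurable
qed

lemma busemann_vol_ge:
  assumes "finite I" "disjoint_family_on S I"
    and S: "\<And>i. i \<in> I \<Longrightarrow> S i \<in> lmeasurable" "\<And>i. i \<in> I \<Longrightarrow> S i \<subseteq> A"
    and m: "\<And>i x. i \<in> I \<Longrightarrow> x \<in> S i \<Longrightarrow> m i \<le> busemann_density K x" "\<And>i. i \<in> I \<Longrightarrow> 0 \<le> m i"
  shows "ennreal (\<Sum>i\<in>I. m i * measure lebesgue (S i)) \<le> busemann_vol K A"
proof -
  have "ennreal (\<Sum>i\<in>I. m i * measure lebesgue (S i)) = (\<Sum>i\<in>I. ennreal (m i * measure lebesgue (S i)))"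
    using m by (subst sum_ennreal) auto
  also have "\<dots> = (\<Sum>i\<in>I. \<integral>\<^sup>+x. ennreal (m i) * indicator (S i) x \<partial>lebesgue)"
  proof (rule sum.cong[OF refl])
    fix i assume i: "i \<in> I"
    have "(\<integral>\<^sup>+x. ennreal (m i) * indicator (S i) x \<partial>lebesgue) = ennreal (m i) * emeasure lebesgue (S i)"
      using S i by (intro nn_integral_cmult_indicator) auto
    also have "\<dots> = ennreal (m i * measure lebesgue (S i))"
      using S i m by (simp add: emeasure_eq_measure2 ennreal_mult)
    finally show "ennreal (m i * measure lebesgue (S i)) = (\<integral>\<^sup>+x. ennreal (m i) * indicator (S i) x \<partial>lebesgue)" by simp
  qed
  also have "\<dots> = (\<integral>\<^sup>+x. (\<Sum>i\<in>I. ennreal (m i) * indicator (S i) x) \<partial>lebesgue)"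
    using S(1)[THEN fmeasurableD]
    by (intro nn_integral_sum[symmetric] borel_measurable_times borel_measurable_indicator) auto
  also have "\<dots> \<le> busemann_vol K A"
    unfolding busemann_vol_def
  proof (rule nn_integral_mono)
    fix x :: "real^2"
    show "(\<Sum>i\<in>I. ennreal (m i) * indicator (S i) x) \<le> ennreal (busemann_density K x) * indicator A x"
    proof (cases "\<exists>i\<in>I. x \<in> S i")
      case True
      then obtain i where i: "i \<in> I" "x \<in> S i" by auto
      have "(\<Sum>k\<in>I. ennreal (m k) * indicator (S k) x) = (\<Sum>k\<in>I. if k = i then ennreal (m i) else 0)"
        using i assms(2) by (intro sum.cong refl) (auto simp: disjoint_family_on_def split: split_indicator)
      also have "\<dots> = ennreal (m i)" using i assms(1) by simp
      also have "\<dots> \<le> ennreal (busemann_density K x) * indicator A x"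
        using i S(2)[OF i(1)] m by (auto intro!: ennreal_leI split: split_indicator)
      finally show ?thesis .
    next
      case False
      then have "(\<Sum>k\<in>I. ennreal (m k) * indicator (S k) x) = 0" by (intro sum.neutral) auto
      then show ?thesis by simp
    qed
  qed
  finally show ?thesis .
qed

section \<open>Volume over one edge\<close>

lemma dyadic_interval:
  fixes y :: real
  assumes "(1/2)^n \<le> y" "y \<le> 1"
  obtains k where "k \<le> n" "(1/2)^(Suc k) \<le> y" "y \<le> (1/2)^k"
proof -
  have "\<exists>k\<le>n. (1/2)^(Suc k) \<le> y \<and> y \<le> (1/2)^k"
    using assms(1)
  proof (induction n)
    case 0
    then show ?case using assms(2) by auto
  next
    case (Suc n)
    show ?case
    proof (cases "(1/2)^n \<le> y")
      case True then show ?thesis using Suc.IH le_SucI by blast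
    next
      case False
      then show ?thesis using Suc.prems by (intro exI[of _ n]) auto
    qed
  qed
  then show ?thesis using that by auto
qed

text \<open>
  The triangle with vertices \<open>0\<close>, \<open>A\<close>, \<open>B\<close> inside a symmetric convex body.
\<close>

locale inscribed_triangle =
  fixes K :: "(real^2) set" and A B :: "real^2" and \<rho> l :: real
  assumes K: "compact K" "convex K" and sym: "\<forall>x\<in>K. - x \<in> K"
    and AB: "A \<in> K" "B \<in> K" "cross2 A B \<noteq> 0"
    and \<rho>: "\<rho> > 0" "cball 0 \<rho> \<subseteq> K"
    and l: "norm (A - B) \<le> l"
begin

lemma three_point_combination: "p \<ge> 0 \<Longrightarrow> q \<ge> 0 \<Longrightarrow> p + q \<le> 1 \<Longrightarrow> z \<in> K \<Longrightarrow>
    p *\<^sub>R A + q *\<^sub>R B + (1 - (p + q)) *\<^sub>R z \<in> K"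
proof (cases "p + q = 0")
  case True
  moreover assume "p \<ge> 0" "q \<ge> 0" "z \<in> K"
  ultimately show ?thesis by (simp add: add_nonneg_eq_0_iff)
next
  case False
  assume *: "p \<ge> 0" "q \<ge> 0" "p + q \<le> 1" "z \<in> K"
  define y where "y = (p/(p+q)) *\<^sub>R A + (q/(p+q)) *\<^sub>R B"
  have "y \<in> K"
    using * False AB K(2) unfolding y_def by (intro convexD) (auto simp: add_divide_distrib[symmetric])
  then have "(p+q) *\<^sub>R y + (1 - (p+q)) *\<^sub>R z \<in> K"
    using * K(2) by (intro convexD) auto
  then show ?thesis using False by (simp add: y_def scaleR_add_right)
qed

lemma A_neq_B: "A \<noteq> B" using AB(3) by (auto simp: cross2_def)

lemma l_pos: "l > 0" using l A_neq_B by (meson less_le_trans right_minus_eq zero_less_norm_iff)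

lemma triangle_ball:
  assumes "p \<ge> 0" "q \<ge> 0" "p + q < 1"
  shows "ball (p *\<^sub>R A + q *\<^sub>R B) ((1 - (p + q)) * \<rho>) \<subseteq> K"
proof
  fix z assume z: "z \<in> ball (p *\<^sub>R A + q *\<^sub>R B) ((1 - (p + q)) * \<rho>)"
  define y where "y = (1 / (1 - (p+q))) *\<^sub>R (z - (p *\<^sub>R A + q *\<^sub>R B))"
  have "norm y = norm (z - (p *\<^sub>R A + q *\<^sub>R B)) / (1 - (p+q))" using assms by (simp add: y_def)
  also have "\<dots> \<le> \<rho>" using z assms by (simp add: dist_norm norm_minus_commute pos_divide_le_eq mult.commute)
  finally have "y \<in> K" using \<rho> by auto
  from three_point_combination[OF assms(1,2) _ this] assms
  have "p *\<^sub>R A + q *\<^sub>R B + (1 - (p + q)) *\<^sub>R y \<in> K" by simp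
  moreover have "(1 - (p + q)) *\<^sub>R y = z - (p *\<^sub>R A + q *\<^sub>R B)"
    unfolding y_def using assms(3) by simp
  ultimately show "z \<in> K" by simp
qed

lemma triangle_interior:
  assumes "p \<ge> 0" "q \<ge> 0" "p + q < 1"
  shows "p *\<^sub>R A + q *\<^sub>R B \<in> interior K"
  using triangle_ball[OF assms] assms \<rho> unfolding mem_interior
  by (intro exI[of _ "(1 - (p + q)) * \<rho>"]) auto

text \<open>
  Two segments centred at \<open>x = p A + q B\<close> lie in \<open>K\<close>. One points away from the origin: with \<open>e\<close>
  the point of \<open>A B\<close> on the ray of \<open>x\<close>, both \<open>x + (1 - t) e = e\<close> and \<open>x - (1 - t) e\<close> are convex
  combinations of \<open>A\<close>, \<open>B\<close>, \<open>e\<close> and \<open>- e\<close>. The other is parallel to \<open>A B\<close>: the weight \<open>min p q\<close> can be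
  moved from one endpoint to the other, and the remaining weight \<open>1 - t\<close>, given to a vector of length
  at most \<open>\<rho>\<close>, adds \<open>(1 - t) \<rho> / l\<close>.
\<close>

lemma density_le:
  assumes pq: "p \<ge> 0" "q \<ge> 0" "p + q < 1"
  shows "busemann_density K (p *\<^sub>R A + q *\<^sub>R B)
     \<le> pi / ((1 - (p+q)) * (min p q + (1 - (p+q)) * \<rho> / l) * \<bar>cross2 A B\<bar>)"
proof -
  define t where "t = p + q"
  define x where "x = p *\<^sub>R A + q *\<^sub>R B"
  \<comment> \<open>At \<open>x = 0\<close> the ray is undefined and any point of \<open>A B\<close> serves.\<close>
  obtain u v where uv: "u \<ge> 0" "v \<ge> 0" "u + v = 1" "x = t *\<^sub>R (u *\<^sub>R A + v *\<^sub>R B)"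
  proof (cases "t = 0")
    case True
    then have "p = 0" "q = 0" using pq t_def by auto
    then show ?thesis using that[of 1 0] by (simp add: x_def t_def)
  next
    case False
    then show ?thesis using that[of "p/t" "q/t"] pq
      by (simp add: x_def t_def add_divide_distrib[symmetric] scaleR_add_right)
  qed
  define e where "e = u *\<^sub>R A + v *\<^sub>R B"
  define h where "h = min p q + (1 - t) * \<rho> / l"
  have eK: "e \<in> K" using uv K AB unfolding e_def by (intro convexD) auto
  have t1: "t < 1" "0 \<le> t" using pq t_def by auto
  have 1: "x + (1-t) *\<^sub>R e \<in> K" "x - (1-t) *\<^sub>R e \<in> K"
  proof -
    have "x + (1-t) *\<^sub>R e = e" unfolding uv(4) e_def[symmetric] by (simp add: algebra_simps)
    then show "x + (1-t) *\<^sub>R e \<in> K" using eK by simp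
    show "x - (1-t) *\<^sub>R e \<in> K"
      using three_point_combination[OF pq(1,2) _ bspec[OF sym eK]] pq by (simp add: x_def t_def)
  qed
  have aux: "x + c *\<^sub>R (h *\<^sub>R (A - B)) \<in> K" if c: "c = 1 \<or> c = -1" for c
  proof -
    define z where "z = (c * (\<rho> / l)) *\<^sub>R (A - B)"
    have "norm z = \<rho> / l * norm (A - B)" using c \<rho> l_pos by (auto simp: z_def)
    also have "\<dots> \<le> \<rho> / l * l" using \<rho> l l_pos by (intro mult_left_mono) auto
    finally have "z \<in> K" using \<rho> l_pos by auto
    then have "(p + c * min p q) *\<^sub>R A + (q - c * min p q) *\<^sub>R B + (1 - ((p + c * min p q) + (q - c * min p q))) *\<^sub>R z \<in> K"
      using pq c by (intro three_point_combination) auto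
    also have "(p + c * min p q) *\<^sub>R A + (q - c * min p q) *\<^sub>R B + (1 - ((p + c * min p q) + (q - c * min p q))) *\<^sub>R z
       = x + c *\<^sub>R (h *\<^sub>R (A - B))"
      unfolding x_def z_def h_def t_def by (simp add: vec_eq_iff algebra_simps)
    finally show ?thesis .
  qed
  have 2: "x + h *\<^sub>R (A - B) \<in> K" "x - h *\<^sub>R (A - B) \<in> K"
    using aux[of 1] aux[of "-1"] by auto
  have h: "h > 0" unfolding h_def using pq t1 \<rho> l_pos by (intro add_nonneg_pos) auto
  have "cross2 ((1-t) *\<^sub>R e) (h *\<^sub>R (A - B)) = - ((1-t) * h * ((u + v) * cross2 A B))"
    unfolding cross2_def e_def by (simp add: algebra_simps)
  then have c: "\<bar>cross2 ((1-t) *\<^sub>R e) (h *\<^sub>R (A - B))\<bar> = (1-t) * h * \<bar>cross2 A B\<bar>"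
    using uv t1 h by (simp add: abs_mult)
  have "busemann_density K x \<le> pi / \<bar>cross2 ((1-t) *\<^sub>R e) (h *\<^sub>R (A - B))\<bar>"
  proof (rule busemann_density_le[OF K _ 1 2])
    show "x \<in> interior K" using triangle_interior[OF pq] x_def by simp
    have "(1-t) * h * \<bar>cross2 A B\<bar> > 0" using h t1 AB by simp
    then show "cross2 ((1-t) *\<^sub>R e) (h *\<^sub>R (A - B)) \<noteq> 0" using c by auto
  qed
  then show ?thesis unfolding c unfolding x_def h_def t_def .
qed

text \<open>
  The part of the triangle at relative depth at least \<open>2\<^sup>-\<^sup>n\<close>.
\<close>

definition trunc :: "nat \<Rightarrow> (real^2) set" where
  "trunc n = {p *\<^sub>R A + q *\<^sub>R B | p q. 0 \<le> p \<and> 0 \<le> q \<and> (1/2)^n \<le> 1 - (p + q)}"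

text \<open>
  In these coordinates the cells below lie in parallelograms whose area is the product of the
  ranges of \<open>p + q\<close> and \<open>p\<close>, times the determinant of \<open>A\<close> and \<open>B\<close>; this determinant cancels
  against the one in the density.
\<close>

lemma coords: "p *\<^sub>R A + q *\<^sub>R B = (p + q) *\<^sub>R B + p *\<^sub>R (A - B)"
  by (simp add: algebra_simps)

lemma cross_coords: "\<bar>cross2 B (A - B)\<bar> = \<bar>cross2 A B\<bar>"
proof -
  have "cross2 B (A - B) = - cross2 A B" by (simp add: cross2_def algebra_simps)
  then show ?thesis by simp
qed

text \<open>
  The extra condition \<open>R\<close> lets the same lemma serve for whole layers and for the half \<open>p \<le> q\<close>.
\<close>

lemma cell_dominated:
  assumes bound: "\<And>p q. 0 \<le> p \<Longrightarrow> 0 \<le> q \<Longrightarrow> R p q \<Longrightarrow> u \<le> 1 - (p+q) \<Longrightarrow> 1 - (p+q) \<le> u' \<Longrightarrow> w \<le> p \<Longrightarrow> p \<le> w' \<Longrightarrow>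
      pi / ((1 - (p+q)) * (min p q + (1 - (p+q)) * \<rho> / l)) \<le> M"
    and u: "0 < u" "u \<le> u'" "w \<le> w'" and M: "0 \<le> M"
  shows "dominated K {p *\<^sub>R A + q *\<^sub>R B | p q. 0 \<le> p \<and> 0 \<le> q \<and> R p q \<and> u \<le> 1 - (p+q) \<and> 1 - (p+q) \<le> u' \<and> w \<le> p \<and> p \<le> w'}
     (ennreal (M * ((u' - u) * (w' - w))))"
proof -
  let ?S = "{p *\<^sub>R A + q *\<^sub>R B | p q. 0 \<le> p \<and> 0 \<le> q \<and> R p q \<and> u \<le> 1 - (p+q) \<and> 1 - (p+q) \<le> u' \<and> w \<le> p \<and> p \<le> w'}"
  let ?P = "paral B (A - B) {1 - u'..1 - u} {w..w'}"
  have D: "\<bar>cross2 A B\<bar> > 0" using AB by simp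
  have "dominated K ?S (ennreal (M / \<bar>cross2 A B\<bar> * measure lebesgue ?P))"
  proof (rule dominated_const)
    show "?P \<in> lmeasurable" using u by (intro paral_lmeasurable) auto
    show "?S \<subseteq> ?P" unfolding paral_def using coords by fastforce
    show "0 \<le> M / \<bar>cross2 A B\<bar>" using M by simp
    fix x assume "x \<in> ?S"
    then obtain p q where x: "x = p *\<^sub>R A + q *\<^sub>R B" "0 \<le> p" "0 \<le> q" "R p q" "u \<le> 1 - (p+q)" "1 - (p+q) \<le> u'" "w \<le> p" "p \<le> w'"
      by auto
    have "busemann_density K x \<le> pi / ((1 - (p+q)) * (min p q + (1 - (p+q)) * \<rho> / l)) / \<bar>cross2 A B\<bar>"
      using density_le[of p q] x u by simp
    also have "\<dots> \<le> M / \<bar>cross2 A B\<bar>" using bound x D by (intro divide_right_mono) auto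
    finally show "busemann_density K x \<le> M / \<bar>cross2 A B\<bar>" .
  qed
  also have "M / \<bar>cross2 A B\<bar> * measure lebesgue ?P = M * ((u' - u) * (w' - w))"
    using u D by (subst measure_paral) (auto simp: cross_coords)
  finally show ?thesis .
qed

text \<open>
  Forget the term \<open>min p q\<close>: on the layer of depth about \<open>2\<^sup>-\<^sup>k\<close> the density is of order
  \<open>4\<^sup>k l\<close> and the area of order \<open>2\<^sup>-\<^sup>k\<close> (both relative to the determinant). The sum over \<open>k \<le> n\<close>
  is geometric.
\<close>

lemma trunc_dominated_linear: "dominated K (trunc n) (ennreal (pi * l * 2^(n+2) / \<rho>))"
proof -
  let ?S = "\<lambda>k. {p *\<^sub>R A + q *\<^sub>R B | p q. 0 \<le> p \<and> 0 \<le> q \<and> True \<and> (1/2)^(Suc k) \<le> 1 - (p+q) \<and> 1 - (p+q) \<le> (1/2)^k \<and> 0 \<le> p \<and> p \<le> 1}"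
  let ?c = "\<lambda>k. pi * l * 2^(k+1) / \<rho>"
  have "dominated K (\<Union>k\<in>{..n}. ?S k) (\<Sum>k\<in>{..n}. ennreal (?c k))"
  proof (rule dominated_finite_UN)
    fix k assume "k \<in> {..n}"
    let ?M = "pi * l * 4^(k+1) / \<rho>"
    have "dominated K (?S k) (ennreal (?M * (((1/2)^k - (1/2)^Suc k) * (1 - 0))))"
    proof (rule cell_dominated)
      fix p q :: real assume *: "0 \<le> p" "0 \<le> q" "(1/2)^(Suc k) \<le> 1 - (p+q)"
      let ?u = "(1/2)^(Suc k) :: real"
      have u: "?u > 0" by simp
      have "?u * (?u * \<rho> / l) \<le> (1 - (p+q)) * (min p q + (1 - (p+q)) * \<rho> / l)"
      proof (intro mult_mono)
        have "?u * \<rho> / l \<le> (1 - (p+q)) * \<rho> / l"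
          using * \<rho> l_pos by (intro divide_right_mono mult_right_mono) auto
        also have "\<dots> \<le> min p q + (1 - (p+q)) * \<rho> / l" using * by auto
        finally show "?u * \<rho> / l \<le> min p q + (1 - (p+q)) * \<rho> / l" .
        show "0 \<le> ?u * \<rho> / l" using \<rho> l_pos by simp
        show "0 \<le> 1 - (p+q)" using * u by linarith
      qed (use * in auto)
      moreover have "0 < ?u * (?u * \<rho> / l)" using u \<rho> l_pos by simp
      ultimately have "pi / ((1 - (p+q)) * (min p q + (1 - (p+q)) * \<rho> / l)) \<le> pi / (?u * (?u * \<rho> / l))"
        by (intro frac_le) auto
      also have "\<dots> = ?M" by (simp add: field_simps power_mult_distrib[symmetric])
      finally show "pi / ((1 - (p+q)) * (min p q + (1 - (p+q)) * \<rho> / l)) \<le> ?M" .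
    qed (use \<rho> l_pos in auto)
    also have "?M * (((1/2)^k - (1/2)^Suc k) * (1 - 0)) = ?c k"
    proof -
      have "(4::real)^k = 2^k * 2^k" by (simp add: power_mult_distrib[symmetric])
      then show ?thesis by (simp add: field_simps)
    qed
    finally show "dominated K (?S k) (ennreal (?c k))" .
  qed auto
  then show ?thesis
  proof (rule dominated_mono)
    show "trunc n \<subseteq> (\<Union>k\<in>{..n}. ?S k)"
    proof
      fix x assume "x \<in> trunc n"
      then obtain p q where x: "x = p *\<^sub>R A + q *\<^sub>R B" "0 \<le> p" "0 \<le> q" "(1/2)^n \<le> 1 - (p + q)"
        unfolding trunc_def by auto
      obtain k where "k \<le> n" "(1/2)^(Suc k) \<le> 1 - (p+q)" "1 - (p+q) \<le> (1/2)^k"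
        using dyadic_interval[OF x(4)] x by auto
      moreover have "p \<le> 1"
        using x(2-4) zero_le_power[of "1/2::real" n] by linarith
      ultimately show "x \<in> (\<Union>k\<in>{..n}. ?S k)" using x by blast
    qed
    have "(\<Sum>k\<in>{..n}. ennreal (?c k)) = ennreal (\<Sum>k\<in>{..n}. ?c k)"
      using \<rho> l_pos by (intro sum_ennreal) auto
    also have "(\<Sum>k\<in>{..n}. ?c k) \<le> pi * l * 2^(n+2) / \<rho>"
    proof -
      have "(\<Sum>k\<in>{..n}. (2::real)^(k+1)) \<le> 2^(n+2)" by (induction n) auto
      moreover have "(\<Sum>k\<in>{..n}. ?c k) = pi * l / \<rho> * (\<Sum>k\<in>{..n}. (2::real)^(k+1))"
        by (simp add: sum_distrib_left)
      moreover have "pi * l / \<rho> \<ge> 0" using \<rho> l_pos by simp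
      ultimately show ?thesis using mult_left_mono by fastforce
    qed
    finally show "(\<Sum>k\<in>{..n}. ennreal (?c k)) \<le> ennreal (pi * l * 2^(n+2) / \<rho>)" by (simp add: ennreal_leI)
  qed
qed

text \<open>
  On the half \<open>p \<le> q\<close>, a cell with depth about \<open>2\<^sup>-\<^sup>k\<close> and \<open>p\<close> about \<open>2\<^sup>-\<^sup>m\<close> has volume at most
  \<open>\<pi>\<close>. The strip \<open>p \<le> 2\<^sup>-\<^sup>n\<close>, where \<open>m\<close> would be unbounded, is one more cell per layer: there the
  depth, being at least \<open>2\<^sup>-\<^sup>n\<close>, takes the place of \<open>p\<close>.
\<close>

lemma half_trunc_dominated:
  "dominated K {p *\<^sub>R A + q *\<^sub>R B | p q. 0 \<le> p \<and> p \<le> q \<and> (1/2)^n \<le> 1 - (p + q)}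
     (ennreal (real (n+1) * (real (n+1) * pi + 2 * pi * l / \<rho>)))"
proof -
  let ?S = "\<lambda>k w w'. {p *\<^sub>R A + q *\<^sub>R B | p q. 0 \<le> p \<and> 0 \<le> q \<and> (p \<le> q) \<and> (1/2)^(Suc k) \<le> 1 - (p+q) \<and> 1 - (p+q) \<le> (1/2)^k \<and> w \<le> p \<and> p \<le> w'}"
  have 1: "dominated K (?S k ((1/2)^Suc m) ((1/2)^m)) (ennreal pi)" for k m
  proof -
    let ?u = "(1/2)^(Suc k) :: real" and ?w = "(1/2)^(Suc m) :: real"
    have pos: "?u > 0" "?w > 0" by simp_all
    have "dominated K (?S k ?w ((1/2)^m)) (ennreal (pi / (?u * ?w) * (((1/2)^k - ?u) * ((1/2)^m - ?w))))"
    proof (rule cell_dominated)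
      fix p q :: real assume *: "0 \<le> p" "0 \<le> q" "p \<le> q" "?u \<le> 1 - (p+q)" "?w \<le> p"
      have "?u * ?w \<le> (1 - (p+q)) * (min p q + (1 - (p+q)) * \<rho> / l)"
      proof (intro mult_mono)
        have "0 \<le> 1 - (p+q)" using *(4) pos(1) by linarith
        then have "0 \<le> (1 - (p+q)) * \<rho> / l" using \<rho> l_pos by simp
        moreover have "min p q = p" using *(3) by simp
        ultimately show "?w \<le> min p q + (1 - (p+q)) * \<rho> / l" using *(5) by linarith
        show "0 \<le> 1 - (p+q)" using * pos by linarith
      qed (use * in auto)
      then show "pi / ((1 - (p+q)) * (min p q + (1 - (p+q)) * \<rho> / l)) \<le> pi / (?u * ?w)"
        using mult_pos_pos[OF pos] by (intro frac_le) auto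
    qed (use pos in auto)
    also have "pi / (?u * ?w) * (((1/2)^k - ?u) * ((1/2)^m - ?w)) = pi"
      by (simp add: field_simps)
    finally show ?thesis .
  qed
  have 2: "dominated K (?S k 0 ((1/2)^n)) (ennreal (2 * pi * l / \<rho>))" if "k \<le> n" for k
  proof -
    let ?u = "(1/2)^(Suc k) :: real" and ?w = "(1/2)^n * \<rho> / (2*l) :: real"
    have pos: "?u > 0" "?w > 0" using \<rho> l_pos by simp_all
    have "dominated K (?S k 0 ((1/2)^n)) (ennreal (pi / (?u * ?w) * (((1/2)^k - ?u) * ((1/2)^n - 0))))"
    proof (rule cell_dominated)
      fix p q :: real assume *: "0 \<le> p" "0 \<le> q" "p \<le> q" "?u \<le> 1 - (p+q)"
      have "?u * ?w \<le> (1 - (p+q)) * (min p q + (1 - (p+q)) * \<rho> / l)"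
      proof (intro mult_mono)
        have "(1/2::real)^n \<le> (1/2)^k" using that by (intro power_decreasing) auto
        moreover have "(1/2::real)^Suc k = (1/2)^k / 2" by simp
        ultimately have "(1/2)^n / 2 \<le> 1 - (p+q)" using *(4) by linarith
        then have "(1/2)^n / 2 * (\<rho> / l) \<le> (1 - (p+q)) * (\<rho> / l)"
          using \<rho> l_pos by (intro mult_right_mono) auto
        then show "?w \<le> min p q + (1 - (p+q)) * \<rho> / l" using * by (simp add: min_def)
        show "0 \<le> 1 - (p+q)" using * pos by linarith
      qed (use * pos in auto)
      then show "pi / ((1 - (p+q)) * (min p q + (1 - (p+q)) * \<rho> / l)) \<le> pi / (?u * ?w)"
        using mult_pos_pos[OF pos] by (intro frac_le) auto
    qed (use pos \<rho> l_pos in auto)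
    also have "pi / (?u * ?w) * (((1/2)^k - ?u) * ((1/2)^n - 0)) = 2 * pi * l / \<rho>"
      using \<rho> l_pos by (simp add: field_simps)
    finally show ?thesis .
  qed
  have layer: "dominated K (\<Union>m\<in>{..n}. ?S k ((1/2)^Suc m) ((1/2)^m)) (\<Sum>m\<in>{..n}. ennreal pi)" for k
    using 1 by (intro dominated_finite_UN) auto
  have "dominated K (\<Union>k\<in>{..n}. (\<Union>m\<in>{..n}. ?S k ((1/2)^Suc m) ((1/2)^m)) \<union> ?S k 0 ((1/2)^n))
     (\<Sum>k\<in>{..n}. (\<Sum>m\<in>{..n}. ennreal pi) + ennreal (2 * pi * l / \<rho>))"
  proof (rule dominated_finite_UN)
    show "dominated K ((\<Union>m\<in>{..n}. ?S k ((1/2)^Suc m) ((1/2)^m)) \<union> ?S k 0 ((1/2)^n))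
       ((\<Sum>m\<in>{..n}. ennreal pi) + ennreal (2 * pi * l / \<rho>))" if "k \<in> {..n}" for k
      using dominated_Un[OF layer 2] that by blast
  qed simp
  then show ?thesis
  proof (rule dominated_mono)
    show "{p *\<^sub>R A + q *\<^sub>R B | p q. 0 \<le> p \<and> p \<le> q \<and> (1/2)^n \<le> 1 - (p + q)}
      \<subseteq> (\<Union>k\<in>{..n}. (\<Union>m\<in>{..n}. ?S k ((1/2)^Suc m) ((1/2)^m)) \<union> ?S k 0 ((1/2)^n))"
    proof
      fix x assume "x \<in> {p *\<^sub>R A + q *\<^sub>R B | p q. 0 \<le> p \<and> p \<le> q \<and> (1/2)^n \<le> 1 - (p + q)}"
      then obtain p q where x: "x = p *\<^sub>R A + q *\<^sub>R B" "0 \<le> p" "p \<le> q" "(1/2)^n \<le> 1 - (p + q)"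
        by auto
      then have q: "0 \<le> q" by simp
      obtain k where k: "k \<le> n" "(1/2)^(Suc k) \<le> 1 - (p+q)" "1 - (p+q) \<le> (1/2)^k"
        using dyadic_interval[OF x(4)] x by auto
      have p1: "p \<le> 1"
        using x(2-4) zero_le_power[of "1/2::real" n] by linarith
      show "x \<in> (\<Union>k\<in>{..n}. (\<Union>m\<in>{..n}. ?S k ((1/2)^Suc m) ((1/2)^m)) \<union> ?S k 0 ((1/2)^n))"
      proof (cases "p \<le> (1/2)^n")
        case True
        then have "x \<in> ?S k 0 ((1/2)^n)" using x k q by blast
        then show ?thesis using k by blast
      next
        case False
        then have "(1/2)^n \<le> p" by simp
        then obtain m where m: "m \<le> n" "(1/2)^(Suc m) \<le> p" "p \<le> (1/2)^m"
          using dyadic_interval p1 by blast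
        then have "x \<in> ?S k ((1/2)^Suc m) ((1/2)^m)" using x k q by blast
        then show ?thesis using k m by blast
      qed
    qed
    have "(\<Sum>k\<in>{..n}. (\<Sum>m\<in>{..n}. ennreal pi) + ennreal (2 * pi * l / \<rho>))
      = (\<Sum>k\<in>{..n}. ennreal (real (n+1) * pi + 2 * pi * l / \<rho>))"
      using \<rho> l_pos by (subst sum_ennreal) auto
    also have "\<dots> = ennreal (\<Sum>k\<in>{..n}. real (n+1) * pi + 2 * pi * l / \<rho>)"
      using \<rho> l_pos by (intro sum_ennreal) auto
    finally show "(\<Sum>k\<in>{..n}. (\<Sum>m\<in>{..n}. ennreal pi) + ennreal (2 * pi * l / \<rho>))
      \<le> ennreal (real (n+1) * (real (n+1) * pi + 2 * pi * l / \<rho>))"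
      by simp
  qed
qed

lemma swap_endpoints: "inscribed_triangle K B A \<rho> l"
proof unfold_locales
  have "cross2 B A = - cross2 A B" by (simp add: cross2_def)
  then show "cross2 B A \<noteq> 0" using AB by simp
qed (use K AB sym \<rho> l in \<open>auto simp: norm_minus_commute\<close>)

lemma trunc_dominated:
  "dominated K (trunc n) (ennreal (2 * real (n+1) * (real (n+1) * pi + 2 * pi * l / \<rho>)))"
proof -
  interpret sw: inscribed_triangle K B A \<rho> l by (rule swap_endpoints)
  let ?c = "real (n+1) * (real (n+1) * pi + 2 * pi * l / \<rho>)"
  have "dominated K (trunc n) (ennreal ?c + ennreal ?c)"
  proof (rule dominated_mono)
    show "dominated K ({p *\<^sub>R A + q *\<^sub>R B | p q. 0 \<le> p \<and> p \<le> q \<and> (1/2)^n \<le> 1 - (p + q)} \<union>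
       {p *\<^sub>R B + q *\<^sub>R A | p q. 0 \<le> p \<and> p \<le> q \<and> (1/2)^n \<le> 1 - (p + q)}) (ennreal ?c + ennreal ?c)"
      by (rule dominated_Un[OF half_trunc_dominated sw.half_trunc_dominated])
  next
    show "trunc n \<subseteq> {p *\<^sub>R A + q *\<^sub>R B | p q. 0 \<le> p \<and> p \<le> q \<and> (1/2)^n \<le> 1 - (p + q)} \<union>
       {p *\<^sub>R B + q *\<^sub>R A | p q. 0 \<le> p \<and> p \<le> q \<and> (1/2)^n \<le> 1 - (p + q)}"
    proof
    fix x assume "x \<in> trunc n"
    then obtain p q where x: "x = p *\<^sub>R A + q *\<^sub>R B" "x = q *\<^sub>R B + p *\<^sub>R A" "0 \<le> p" "0 \<le> q"
      "(1/2)^n \<le> 1 - (p + q)" "(1/2)^n \<le> 1 - (q + p)"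
      unfolding trunc_def by (auto simp: add.commute)
    show "x \<in> {p *\<^sub>R A + q *\<^sub>R B | p q. 0 \<le> p \<and> p \<le> q \<and> (1/2)^n \<le> 1 - (p + q)} \<union>
       {p *\<^sub>R B + q *\<^sub>R A | p q. 0 \<le> p \<and> p \<le> q \<and> (1/2)^n \<le> 1 - (p + q)}"
    proof (cases "p \<le> q")
      case True then show ?thesis using x by blast
    next
      case False then have "q \<le> p" by simp
      then show ?thesis using x by blast
    qed
    qed
  qed simp
  also have "ennreal ?c + ennreal ?c = ennreal (?c + ?c)"
    using \<rho> l_pos by (intro ennreal_plus[symmetric]) auto
  also have "?c + ?c = 2 * real (n+1) * (real (n+1) * pi + 2 * pi * l / \<rho>)" by (simp add: algebra_simps add_divide_distrib)
  finally show ?thesis .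
qed

end

section \<open>Points on the unit circle\<close>

definition circ :: "real \<Rightarrow> real^2" where
  "circ \<phi> = vector [cos \<phi>, sin \<phi>]"

lemma circ_nth [simp]: "circ \<phi> $ 1 = cos \<phi>" "circ \<phi> $ 2 = sin \<phi>"
  by (simp_all add: circ_def)

lemma inner_circ: "circ a \<bullet> circ b = cos (a - b)"
  by (simp add: inner_vec_def sum_2 cos_diff)

lemma norm_circ [simp]: "norm (circ a) = 1"
  by (simp add: norm_eq_sqrt_inner inner_circ)

lemma cross2_circ: "cross2 (circ a) (circ b) = sin (b - a)"
  by (simp add: cross2_def sin_diff)

lemma circ_add_pi: "circ (a + pi) = - circ a"
  by (simp add: vec_eq_iff forall_2)

lemma polar_coordinates:
  obtains r \<phi> where "r \<ge> 0" "\<phi>0 \<le> \<phi>" "\<phi> < \<phi>0 + 2 * pi" "x = r *\<^sub>R circ \<phi>"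
proof -
  have base: "\<exists>r \<phi>. r \<ge> 0 \<and> 0 \<le> \<phi> \<and> \<phi> < 2 * pi \<and> y = r *\<^sub>R circ \<phi>" for y :: "real^2"
  proof (cases "y = 0")
    case True
    then show ?thesis by (intro exI[of _ 0]) auto
  next
    case False
    then have n: "norm y > 0" by simp
    have "(y$1 / norm y)\<^sup>2 + (y$2 / norm y)\<^sup>2 = ((y$1)\<^sup>2 + (y$2)\<^sup>2) / (norm y)\<^sup>2"
      by (simp add: power_divide add_divide_distrib)
    also have "(y$1)\<^sup>2 + (y$2)\<^sup>2 = (norm y)\<^sup>2"
      unfolding power2_norm_eq_inner by (simp add: inner_vec_def sum_2 power2_eq_square)
    finally have "(y$1 / norm y)\<^sup>2 + (y$2 / norm y)\<^sup>2 = 1" using n by simp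
    then obtain t where t: "0 \<le> t" "t < 2*pi" "y$1 / norm y = cos t" "y$2 / norm y = sin t"
      by (rule sincos_total_2pi)
    have "y = norm y *\<^sub>R circ t"
      using n t(3,4)[symmetric] by (simp add: vec_eq_iff forall_2)
    then show ?thesis using t n by (intro exI[of _ "norm y"] exI[of _ t]) auto
  qed
  \<comment> \<open>Rotate by \<open>- \<phi>0\<close>, use the case of base angle 0, and rotate back.\<close>
  define y :: "real^2" where "y = vector [x$1 * cos \<phi>0 + x$2 * sin \<phi>0, x$2 * cos \<phi>0 - x$1 * sin \<phi>0]"
  obtain r t where rt: "r \<ge> 0" "0 \<le> t" "t < 2 * pi" "y = r *\<^sub>R circ t" using base by blast
  have y: "y$1 = r * cos t" "y$2 = r * sin t" using rt(4) by simp_all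
  have "x$1 = y$1 * cos \<phi>0 - y$2 * sin \<phi>0" "x$2 = y$1 * sin \<phi>0 + y$2 * cos \<phi>0"
  proof -
    have yy: "y$1 = x$1 * cos \<phi>0 + x$2 * sin \<phi>0" "y$2 = x$2 * cos \<phi>0 - x$1 * sin \<phi>0"
      by (simp_all add: y_def)
    show "x$1 = y$1 * cos \<phi>0 - y$2 * sin \<phi>0"
      unfolding yy using sin_cos_squared_add[of \<phi>0] by algebra
    show "x$2 = y$1 * sin \<phi>0 + y$2 * cos \<phi>0"
      unfolding yy using sin_cos_squared_add[of \<phi>0] by algebra
  qed
  then have "x = r *\<^sub>R circ (\<phi>0 + t)"
    using y by (simp add: vec_eq_iff forall_2 cos_add sin_add algebra_simps)
  then show ?thesis using that[of r "\<phi>0 + t"] rt by simp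
qed

lemma rotation_matrix_circ:
  assumes "rotation_matrix (Q :: real^2^2)"
  obtains \<phi>0 where "\<And>\<phi>. Q *v circ \<phi> = circ (\<phi>0 + \<phi>)"
proof -
  define a b c d where "a = Q$1$1" and "b = Q$1$2" and "c = Q$2$1" and "d = Q$2$2"
  have "transpose Q ** Q = mat 1" and det: "a * d - b * c = 1"
    using assms by (auto simp: rotation_matrix_def orthogonal_matrix_def det_2 a_def b_def c_def d_def)
  then have "(transpose Q ** Q) $ 1 $ 1 = 1" "(transpose Q ** Q) $ 1 $ 2 = 0" by (simp_all add: mat_def)
  then have 1: "a * a + c * c = 1" and 2: "a * b + c * d = 0"
    by (simp_all add: matrix_matrix_mult_def transpose_def sum_2 a_def b_def c_def d_def)
  have d: "d = a" and b: "b = - c" using 1 2 det by algebra+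
  obtain t where t: "a = cos t" "c = sin t"
    using sincos_total_2pi[of a c] 1 by (auto simp: power2_eq_square)
  have "Q *v circ \<phi> = circ (t + \<phi>)" for \<phi>
    using t d b by (simp add: vec_eq_iff forall_2 matrix_vector_mult_def sum_2 cos_add sin_add
        a_def b_def c_def d_def)
  then show ?thesis using that by blast
qed

lemma cos_le_cos_outside:
  assumes "0 \<le> h" "h \<le> \<bar>x\<bar>" "\<bar>x\<bar> \<le> 2 * pi - h"
  shows "cos x \<le> cos h"
proof (cases "\<bar>x\<bar> \<le> pi")
  case True
  then have "cos \<bar>x\<bar> \<le> cos h" using assms by (intro cos_monotone_0_pi_le) auto
  then show ?thesis by simp
next
  case False
  have "cos (2 * pi - \<bar>x\<bar>) \<le> cos h" using assms False by (intro cos_monotone_0_pi_le) auto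
  then show ?thesis by (simp add: cos_diff)
qed

section \<open>Edges of a body inscribed in the unit disc\<close>

text \<open>
  The chord from \<open>circ a\<close> to \<open>circ b\<close> is an edge of \<open>K\<close>: the line through it, whose unit normal is the
  midpoint of the arc and whose distance from the origin is the cosine of the half angle, supports \<open>K\<close>.
\<close>

definition edge_arc :: "(real^2) set \<Rightarrow> real \<Rightarrow> real \<Rightarrow> bool" where
  "edge_arc K a b \<longleftrightarrow> a < b \<and> b < a + pi \<and> circ a \<in> K \<and> circ b \<in> K \<and>
     (\<forall>z\<in>K. z \<bullet> circ ((a + b) / 2) \<le> cos ((b - a) / 2))"

definition sector :: "real \<Rightarrow> real \<Rightarrow> (real^2) set" where
  "sector a b = {p *\<^sub>R circ a + q *\<^sub>R circ b | p q. 0 \<le> p \<and> 0 \<le> q}"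

lemma edge_arc_opposite:
  assumes "edge_arc K a b" and sym: "\<forall>x\<in>K. - x \<in> K"
  shows "edge_arc K (a + pi) (b + pi)"
proof -
  have "(a + pi + (b + pi)) / 2 = (a + b) / 2 + pi" by simp
  then have "circ ((a + pi + (b + pi)) / 2) = - circ ((a + b) / 2)" by (metis circ_add_pi)
  moreover have "z \<bullet> - circ ((a + b) / 2) \<le> cos ((b - a) / 2)" if "z \<in> K" for z
    using assms(1) bspec[OF sym that] unfolding edge_arc_def by (metis inner_minus_left inner_minus_right)
  ultimately show ?thesis using assms unfolding edge_arc_def by (auto simp: circ_add_pi)
qed

lemma edge_arc_cos_pos: "edge_arc K a b \<Longrightarrow> cos ((b - a) / 2) > 0"
  unfolding edge_arc_def by (intro cos_gt_zero_pi) auto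

lemma edge_arc_height:
  "(p *\<^sub>R circ a + q *\<^sub>R circ b) \<bullet> circ ((a + b) / 2) = (p + q) * cos ((b - a) / 2)"
proof -
  have "a - (a + b) / 2 = - ((b - a) / 2)" "b - (a + b) / 2 = (b - a) / 2" by (simp_all add: field_simps)
  then show ?thesis by (simp only: inner_add_left inner_scaleR_left inner_circ cos_minus) (simp add: algebra_simps)
qed

text \<open>
  Moving from the centre of the ball in the normal direction does not cross the edge line, whose
  distance from the origin is at most 1.
\<close>

lemma edge_arc_depth:
  assumes arc: "edge_arc K a b" and ball: "ball (p *\<^sub>R circ a + q *\<^sub>R circ b) \<delta> \<subseteq> K"
    and pos: "0 < \<delta>"
  shows "\<delta> \<le> 1 - (p + q)"
proof (rule ccontr)
  assume "\<not> ?thesis"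
  then have \<delta>: "1 - (p + q) < \<delta>" by simp
  define x where "x = p *\<^sub>R circ a + q *\<^sub>R circ b"
  define h where "h = cos ((b - a) / 2)"
  have h: "0 < h" "h \<le> 1" using edge_arc_cos_pos[OF arc] h_def by auto
  obtain e where e: "max 0 (1 - (p + q)) < e" "e < \<delta>"
    using dense[of "max 0 (1 - (p+q))" \<delta>] \<delta> pos by auto
  have "x + e *\<^sub>R circ ((a + b) / 2) \<in> K"
    using ball e by (auto simp: x_def dist_norm)
  then have "(x + e *\<^sub>R circ ((a + b) / 2)) \<bullet> circ ((a + b) / 2) \<le> h"
    using arc unfolding edge_arc_def h_def by blast
  moreover have "x \<bullet> circ ((a + b) / 2) = (p + q) * h"
    unfolding x_def h_def by (rule edge_arc_height)
  ultimately have "(p + q) * h + e \<le> h"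
    by (simp add: inner_add_left inner_circ)
  then have le: "e \<le> h * (1 - (p+q))" by (simp add: algebra_simps)
  then have "0 < h * (1 - (p+q))" using e by linarith
  then have "0 < 1 - (p+q)" using h by (simp add: zero_less_mult_iff)
  then have "h * (1 - (p+q)) \<le> 1 * (1 - (p+q))" using h by (intro mult_right_mono) auto
  then show False using le e by auto
qed

lemma chord_le_arc:
  assumes "a < b" shows "norm (circ a - circ b) \<le> b - a"
proof (rule power2_le_imp_le)
  have "(norm (circ a - circ b))\<^sup>2 = 2 - 2 * cos (b - a)"
    by (simp add: power2_norm_eq_inner inner_diff_left inner_diff_right inner_circ cos_diff algebra_simps)
  also have "\<dots> = 4 * (sin ((b-a)/2))\<^sup>2"
  proof -
    have "2 * ((b-a)/2) = b - a" by simp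
    then have "cos (b - a) = 1 - 2 * (sin ((b-a)/2))\<^sup>2" using cos_double_sin[of "(b-a)/2"] by metis
    then show ?thesis by simp
  qed
  also have "\<dots> \<le> 4 * ((b-a)/2)\<^sup>2"
    using abs_sin_x_le_abs_x[of "(b-a)/2"] by (simp add: abs_le_square_iff[symmetric])
  also have "\<dots> = (b-a)\<^sup>2" by (simp add: power2_eq_square)
  finally show "(norm (circ a - circ b))\<^sup>2 \<le> (b-a)\<^sup>2" .
qed (use assms in simp)

lemma sin_ge_half: "0 \<le> x \<Longrightarrow> x\<^sup>2 \<le> 2 \<Longrightarrow> x / 2 \<le> sin (x::real)"
proof -
  assume x: "0 \<le> x" "x\<^sup>2 \<le> 2"
  have "\<bar>sin x - (\<Sum>m<3. sin_coeff m * x ^ m)\<bar> \<le> inverse (fact 3) * \<bar>x\<bar> ^ 3"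
    by (rule Maclaurin_sin_bound)
  also have "(\<Sum>m<3. sin_coeff m * x ^ m) = x" by (simp add: sin_coeff_def eval_nat_numeral)
  also have "inverse (fact 3) * \<bar>x\<bar> ^ 3 = x\<^sup>2 * x / 6" using x(1) by (simp add: eval_nat_numeral)
  also have "\<dots> \<le> 2 * x / 6" using x by (intro divide_right_mono mult_right_mono) auto
  finally have "\<bar>sin x - x\<bar> \<le> 2 * x / 6" .
  then show ?thesis using x(1) by linarith
qed

text \<open>
  With \<open>\<alpha> = b - a\<close>, a parallelogram inside the triangle \<open>0\<close>, \<open>circ a\<close>, \<open>circ b\<close> at relative depth
  between \<open>\<alpha>\<^sup>2/8\<close> and \<open>\<alpha>\<^sup>2/4\<close>. The range \<open>[1/4, 1/2]\<close> keeps it off both sides of the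
  triangle, so that cells of different edges are disjoint.
\<close>

definition cap_cell :: "real \<Rightarrow> real \<Rightarrow> (real^2) set" where
  "cap_cell a b = paral (circ b) (circ a - circ b) {1 - (b-a)\<^sup>2/4..1 - (b-a)\<^sup>2/8} {1/4..1/2}"

lemma cap_cell_coords:
  assumes "x \<in> cap_cell a b" "(b - a)\<^sup>2 < 2"
  obtains p q where "x = p *\<^sub>R circ a + q *\<^sub>R circ b" "0 < p" "0 < q"
    "(b-a)\<^sup>2/8 \<le> 1 - (p + q)" "1 - (p + q) \<le> (b-a)\<^sup>2/4"
proof -
  obtain t p where *: "x = t *\<^sub>R circ b + p *\<^sub>R (circ a - circ b)"
     "t \<in> {1 - (b-a)\<^sup>2/4..1 - (b-a)\<^sup>2/8}" "p \<in> {1/4..1/2}"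
    using assms(1) unfolding cap_cell_def paral_def by auto
  show ?thesis
    by (rule that[of p "t - p"]) (use * assms(2) in \<open>auto simp: algebra_simps\<close>)
qed

lemma cap_cell_measure:
  assumes "a < b" "(b - a)\<^sup>2 < 2"
  shows "cap_cell a b \<in> lmeasurable" "(b - a)^3 / 64 \<le> measure lebesgue (cap_cell a b)"
proof -
  have ne: "1 - (b-a)\<^sup>2/4 \<le> 1 - (b-a)\<^sup>2/8" by simp
  show "cap_cell a b \<in> lmeasurable" unfolding cap_cell_def
    using ne by (intro paral_lmeasurable) auto
  have "cross2 (circ b) (circ a - circ b) = - sin (b - a)"
    by (simp add: cross2_def sin_diff algebra_simps)
  moreover have s: "(b - a) / 2 \<le> sin (b - a)" using assms by (intro sin_ge_half) auto
  ultimately have "measure lebesgue (cap_cell a b) = sin (b-a) * ((b-a)\<^sup>2/8 * (1/4))"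
    unfolding cap_cell_def using ne assms by (subst measure_paral) auto
  moreover have "(b - a)/2 * ((b-a)\<^sup>2/8 * (1/4)) \<le> sin (b-a) * ((b-a)\<^sup>2/8 * (1/4))"
    using s by (intro mult_right_mono) auto
  ultimately show "(b - a)^3 / 64 \<le> measure lebesgue (cap_cell a b)"
    by (simp add: power3_eq_cube power2_eq_square)
qed

text \<open>
  Let \<open>n\<close> be the normal of the edge, \<open>\<tau>\<close> its direction and \<open>x \<plusminus> v \<in> K\<close>. The edge line bounds
  \<open>v \<bullet> n\<close> by the depth of \<open>x\<close>. Hence \<open>x \<plusminus> v\<close> lie in the part of the unit disc at most twice that
  depth below the edge, and since the endpoints of the edge are on the unit circle, this cap has
  width of order \<open>\<alpha>\<close>; this bounds \<open>v \<bullet> \<tau>\<close>.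
\<close>

lemma cap_density_ge:
  assumes K: "compact K" "convex K" "K \<subseteq> cball 0 1" and arc: "edge_arc K a b"
    and ab: "(b - a)\<^sup>2 < 2"
    and x: "x = p *\<^sub>R circ a + q *\<^sub>R circ b" "x \<in> interior K" "1 - (p + q) \<le> (b-a)\<^sup>2/4"
  shows "pi / (8 * (b - a)^3) \<le> busemann_density K x"
proof -
  define \<alpha> where "\<alpha> = b - a"
  define m where "m = (a + b) / 2"
  define n where "n = circ m"
  define \<tau> where "\<tau> = circ (m + pi/2)"
  define h where "h = cos (\<alpha> / 2)"
  define t where "t = p + q"
  have \<alpha>: "\<alpha> > 0" "\<alpha>\<^sup>2 < 2" using arc ab unfolding edge_arc_def \<alpha>_def by auto
  have h: "0 < h" "h \<le> 1" using edge_arc_cos_pos[OF arc] by (auto simp: h_def \<alpha>_def)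
  have xn: "x \<bullet> n = t * h" unfolding x(1) n_def m_def h_def \<alpha>_def t_def by (rule edge_arc_height)
  have nt: "n \<bullet> n = 1" "\<tau> \<bullet> \<tau> = 1" "n \<bullet> \<tau> = 0" "\<tau> \<bullet> n = 0"
    by (simp_all add: n_def \<tau>_def inner_circ)
  have cr: "cross2 n \<tau> = 1" by (simp add: n_def \<tau>_def cross2_circ)
  have decomp: "v = (v \<bullet> n) *\<^sub>R n + (v \<bullet> \<tau>) *\<^sub>R \<tau>" for v
  proof -
    have vn: "v \<bullet> n = v$1 * cos m + v$2 * sin m" and vt: "v \<bullet> \<tau> = v$2 * cos m - v$1 * sin m"
      by (simp_all add: n_def \<tau>_def inner_vec_def sum_2 cos_add sin_add)
    have comp: "n$1 = cos m" "n$2 = sin m" "\<tau>$1 = - sin m" "\<tau>$2 = cos m"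
      by (simp_all add: n_def \<tau>_def cos_add sin_add)
    show ?thesis
      unfolding vec_eq_iff forall_2 vn vt vector_add_component vector_scaleR_component comp real_scaleR_def
      using sin_cos_squared_add[of m] by (intro conjI; algebra)
  qed
  have pyth: "(norm v)\<^sup>2 = (v \<bullet> n)\<^sup>2 + (v \<bullet> \<tau>)\<^sup>2" for v
  proof -
    have "v \<bullet> v = v \<bullet> ((v \<bullet> n) *\<^sub>R n + (v \<bullet> \<tau>) *\<^sub>R \<tau>)"
      using arg_cong[OF decomp[of v], of "\<lambda>u. v \<bullet> u"] .
    then show ?thesis unfolding power2_norm_eq_inner by (simp add: inner_add_right power2_eq_square)
  qed
  have "1 - t \<le> \<alpha>\<^sup>2/4" using x(3) unfolding t_def \<alpha>_def .
  then have t: "1/2 \<le> t" "1 - t \<le> \<alpha>\<^sup>2/4" using \<alpha>(2) by linarith+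
  have top: "z \<bullet> n \<le> h" if "z \<in> K" for z
    using arc that unfolding edge_arc_def n_def m_def h_def \<alpha>_def by auto
  have wide: "\<bar>z \<bullet> \<tau>\<bar> \<le> 2 * \<alpha>" if z: "z \<in> K" "z \<bullet> n \<ge> h - 2 * (1-t) * h" for z
  proof -
    have "0 \<le> (2*t - 1) * h" using t h by simp
    moreover have eq: "h - 2 * (1-t) * h = (2*t - 1) * h" by (simp add: algebra_simps)
    ultimately have "((2*t-1)*h)\<^sup>2 \<le> (z \<bullet> n)\<^sup>2" using z(2) by (intro power_mono) auto
    moreover have "(norm z)\<^sup>2 \<le> 1" using z(1) K(3) by (auto simp: power_le_one)
    ultimately have "(z \<bullet> \<tau>)\<^sup>2 \<le> 1 - ((2*t-1)*h)\<^sup>2" using pyth[of z] by linarith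
    also have "\<dots> = (1 - h\<^sup>2) + 4 * t * (1-t) * h\<^sup>2" by (simp add: power2_eq_square algebra_simps)
    also have "1 - h\<^sup>2 = (sin (\<alpha>/2))\<^sup>2" by (simp add: h_def sin_squared_eq)
    also have "\<dots> \<le> (\<alpha>/2)\<^sup>2" using abs_sin_x_le_abs_x[of "\<alpha>/2"] by (simp only: abs_le_square_iff)
    also have "4 * t * (1-t) * h\<^sup>2 \<le> 4 * (\<alpha>\<^sup>2/4)"
    proof -
      have "t * (1-t) \<le> \<alpha>\<^sup>2/4"
      proof (cases "1 - t \<ge> 0")
        case True
        then have "t * (1-t) \<le> 1 * (1-t)" by (intro mult_right_mono) auto
        then show ?thesis using t by simp
      next
        case False
        then have "t * (1-t) \<le> 0" using t by (intro mult_nonneg_nonpos) auto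
        then show ?thesis using zero_le_power2[of \<alpha>] by linarith
      qed
      moreover have "h\<^sup>2 \<le> 1" using h by (simp add: power_le_one)
      ultimately have "t * (1-t) * h\<^sup>2 \<le> (\<alpha>\<^sup>2/4) * 1"
        by (intro mult_mono) auto
      then show ?thesis by simp
    qed
    also have "(\<alpha>/2)\<^sup>2 + 4 * (\<alpha>\<^sup>2/4) \<le> (2 * \<alpha>)\<^sup>2" by (simp add: power2_eq_square)
    finally show ?thesis using \<alpha> abs_le_square_iff[of "z \<bullet> \<tau>" "2*\<alpha>"] by simp
  qed
  have "pi / (16 * (\<alpha>\<^sup>2/4) * (2*\<alpha>) * \<bar>cross2 n \<tau>\<bar>) \<le> busemann_density K x"
  proof (rule busemann_density_ge[OF K(1,2) x(2)])
    fix v assume v: "x + v \<in> K" "x - v \<in> K"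
    have vn: "\<bar>v \<bullet> n\<bar> \<le> (1-t) * h"
      using top[OF v(1)] top[OF v(2)] xn by (simp add: inner_add_left inner_diff_left algebra_simps abs_le_iff)
    have "\<bar>(x + v) \<bullet> \<tau>\<bar> \<le> 2 * \<alpha>" "\<bar>(x - v) \<bullet> \<tau>\<bar> \<le> 2 * \<alpha>"
      using vn xn by (intro wide v; simp add: inner_add_left inner_diff_left algebra_simps abs_le_iff)+
    then have vt: "\<bar>v \<bullet> \<tau>\<bar> \<le> 2 * \<alpha>" by (simp add: inner_add_left inner_diff_left abs_le_iff)
    have "(1-t) * h \<le> \<alpha>\<^sup>2/4"
    proof (cases "1 - t \<ge> 0")
      case True
      then have "(1-t) * h \<le> (1-t) * 1" using h by (intro mult_left_mono) auto
      then show ?thesis using t by simp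
    next
      case False
      then have "(1-t) * h \<le> 0" using h by (intro mult_nonpos_nonneg) auto
      then show ?thesis using zero_le_power2[of \<alpha>] by linarith
    qed
    then have "\<bar>v \<bullet> n\<bar> \<le> \<alpha>\<^sup>2/4" using vn by linarith
    then show "v \<in> paral n \<tau> {-(\<alpha>\<^sup>2/4)..\<alpha>\<^sup>2/4} {-(2*\<alpha>)..2*\<alpha>}"
      unfolding paral_def using vt
      by (intro CollectI exI[of _ "v \<bullet> n"] exI[of _ "v \<bullet> \<tau>"] conjI decomp) (auto simp: abs_le_iff)
  qed (use \<alpha> in auto)
  moreover have "16 * (\<alpha>\<^sup>2/4) * (2*\<alpha>) * \<bar>cross2 n \<tau>\<bar> = 8 * \<alpha>^3"
    by (simp add: cr power2_eq_square power3_eq_cube)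
  ultimately have "pi / (8 * \<alpha>^3) \<le> busemann_density K x" by metis
  then show ?thesis unfolding \<alpha>_def .
qed

text \<open>
  The coordinates come from Cramer's rule for \<open>circ a\<close>, \<open>circ b\<close>; both are non-negative because all angle
  differences are between 0 and \<open>\<pi>\<close>.
\<close>

lemma sector_polar:
  assumes "a \<le> \<phi>" "\<phi> \<le> b" "a < b" "b < a + pi" "0 \<le> r"
  shows "r *\<^sub>R circ \<phi> \<in> sector a b"
proof -
  have s: "sin (b - a) > 0" using assms by (intro sin_gt_zero) auto
  have "sin (b - \<phi>) \<ge> 0" "sin (\<phi> - a) \<ge> 0" using assms by (auto intro!: sin_ge_zero)
  moreover have "sin (b - a) *\<^sub>R circ \<phi> = sin (b - \<phi>) *\<^sub>R circ a + sin (\<phi> - a) *\<^sub>R circ b"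
    by (simp add: vec_eq_iff forall_2 sin_diff algebra_simps)
  then have "(r / sin (b - a)) *\<^sub>R (sin (b - a) *\<^sub>R circ \<phi>)
      = (r / sin (b - a)) *\<^sub>R (sin (b - \<phi>) *\<^sub>R circ a + sin (\<phi> - a) *\<^sub>R circ b)"
    by simp
  then have "r *\<^sub>R circ \<phi> = (r / sin (b - a) * sin (b - \<phi>)) *\<^sub>R circ a + (r / sin (b - a) * sin (\<phi> - a)) *\<^sub>R circ b"
    using s by (simp add: scaleR_add_right)
  ultimately show ?thesis unfolding sector_def using s assms(5)
    by (intro CollectI exI[of _ "r / sin (b - a) * sin (b - \<phi>)"] exI[of _ "r / sin (b - a) * sin (\<phi> - a)"]) simp
qed

text \<open>
  The ray through \<open>circ b\<close> separates the two open sectors.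
\<close>

lemma cap_cells_disjoint:
  assumes "a < b" "b \<le> c" "c < d" "d < a + pi" "(b - a)\<^sup>2 < 2" "(d - c)\<^sup>2 < 2"
  shows "cap_cell a b \<inter> cap_cell c d = {}"
proof (rule ccontr)
  assume "\<not> ?thesis"
  then obtain x where x: "x \<in> cap_cell a b" "x \<in> cap_cell c d" by auto
  obtain p q where p: "x = p *\<^sub>R circ a + q *\<^sub>R circ b" "0 < p" using cap_cell_coords[OF x(1) assms(5)] by metis
  obtain p' q' where q: "x = p' *\<^sub>R circ c + q' *\<^sub>R circ d" "0 < p'" "0 < q'" using cap_cell_coords[OF x(2) assms(6)] by metis
  have "cross2 (circ b) x = p * cross2 (circ b) (circ a)"
    unfolding p(1) by (simp add: cross2_def algebra_simps)
  also have "\<dots> = - (p * sin (b - a))" unfolding cross2_circ by (simp add: sin_diff algebra_simps)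
  also have "\<dots> < 0" using p sin_gt_zero[of "b - a"] assms by simp
  finally have "cross2 (circ b) x < 0" .
  moreover have "cross2 (circ b) x = p' * cross2 (circ b) (circ c) + q' * cross2 (circ b) (circ d)"
    unfolding q(1) by (simp add: cross2_def algebra_simps)
  then have "cross2 (circ b) x = p' * sin (c - b) + q' * sin (d - b)" by (simp add: cross2_circ)
  moreover have "\<dots> \<ge> 0"
    using q assms by (intro add_nonneg_nonneg mult_nonneg_nonneg sin_ge_zero) auto
  ultimately show False by simp
qed

lemma edge_arc_triangle:
  assumes K: "compact K" "convex K" "\<forall>x\<in>K. - x \<in> K" and \<rho>: "0 < \<rho>" "cball 0 \<rho> \<subseteq> K"
    and arc: "edge_arc K a b" and l: "norm (circ a - circ b) \<le> l"
  shows "inscribed_triangle K (circ a) (circ b) \<rho> l"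
proof unfold_locales
  have "sin (b - a) > 0" using arc unfolding edge_arc_def by (intro sin_gt_zero) auto
  then show "cross2 (circ a) (circ b) \<noteq> 0" by (simp add: cross2_circ)
qed (use assms in \<open>auto simp: edge_arc_def\<close>)

lemma ball_symmetric_convex:
  assumes "convex K" "\<forall>x\<in>K. - x \<in> K" "ball p \<rho> \<subseteq> K"
  shows "ball (0::real^2) \<rho> \<subseteq> K"
proof
  fix z :: "real^2" assume z: "z \<in> ball 0 \<rho>"
  then have "p + z \<in> K" "p + (- z) \<in> K" using assms(3) by (auto simp: dist_norm)
  then have "p + z \<in> K" "- (p + (- z)) \<in> K" using assms(2) by blast+
  then have "(1/2) *\<^sub>R (p + z) + (1/2) *\<^sub>R (- (p + (- z))) \<in> K"
    by (intro convexD[OF assms(1)]) simp_all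
  moreover have "(1/2) *\<^sub>R (p + z) + (1/2) *\<^sub>R (- (p + (- z))) = z"
    by (simp add: vec_eq_iff algebra_simps)
  ultimately show "z \<in> K" by simp
qed

text \<open>
  For the bound that does not see the length of the edge, the chord is estimated by the
  diameter 2.
\<close>

lemma hilbert_ball_sector_dominated:
  assumes K: "compact K" "convex K" "\<forall>x\<in>K. - x \<in> K"
    and \<rho>: "0 < \<rho>" "ball p \<rho> \<subseteq> K" and r: "0 < r" and n: "(1/2)^n \<le> \<rho> * exp (-2 * r)"
    and arc: "edge_arc K a b"
  shows "dominated K (hilbert_ball K p r \<inter> sector a b)
           (ennreal (2 * real (n+1) * (real (n+1) * pi + 8 * pi / \<rho>)))" (is ?A)
    and "dominated K (hilbert_ball K p r \<inter> sector a b) (ennreal (2 * pi * 2^(n+2) / \<rho> * (b - a)))" (is ?B)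
proof -
  have "ball 0 \<rho> \<subseteq> K" using ball_symmetric_convex[OF K(2,3) \<rho>(2)] by blast
  moreover have "cball 0 (\<rho>/2) \<subseteq> ball (0::real^2) \<rho>" using \<rho>(1) by auto
  ultimately have c: "0 < \<rho>/2" "cball 0 (\<rho>/2) \<subseteq> K" using \<rho> by auto
  have "norm (circ a - circ b) \<le> 2" using norm_triangle_ineq4[of "circ a" "circ b"] by simp
  then interpret t1: inscribed_triangle K "circ a" "circ b" "\<rho>/2" 2
    using edge_arc_triangle K c arc by blast
  have "norm (circ a - circ b) \<le> b - a" using chord_le_arc arc unfolding edge_arc_def by blast
  then interpret t2: inscribed_triangle K "circ a" "circ b" "\<rho>/2" "b - a"
    using edge_arc_triangle K c arc by blast
  have sub: "hilbert_ball K p r \<inter> sector a b \<subseteq> t1.trunc n"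
  proof
    fix x assume x: "x \<in> hilbert_ball K p r \<inter> sector a b"
    then obtain u v where uv: "x = u *\<^sub>R circ a + v *\<^sub>R circ b" "0 \<le> u" "0 \<le> v"
      unfolding sector_def by auto
    have "ball x (\<rho> * exp (- 2 * r)) \<subseteq> K" using hilbert_ball_imp_ball[OF K(1,2) \<rho> r] x by auto
    then have "\<rho> * exp (- 2 * r) \<le> 1 - (u + v)" using edge_arc_depth[OF arc] \<rho> uv(1) by simp
    then show "x \<in> t1.trunc n" unfolding t1.trunc_def using uv n by force
  qed
  show ?A using dominated_mono[OF t1.trunc_dominated sub order_refl] by simp
  show ?B using dominated_mono[OF t2.trunc_dominated_linear sub order_refl]
    by (simp add: mult_ac)
qed

section \<open>The body with lacunary vertices\<close>

text \<open>
  The rotation is encoded by the base angle \<open>\<phi>0\<close>.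
\<close>

locale lacunary_body =
  fixes s C \<phi>0 :: real and \<theta> :: "nat \<Rightarrow> real" and K :: "(real^2) set"
  assumes s: "s > 2" and C: "C > 0"
    and total: "3 * (\<Sum>i. C / real (Suc i) powr s) < pi"
    and \<theta>0: "\<theta> 0 = 0" and \<theta>_step: "\<And>j. \<theta> (Suc j) - \<theta> j = C / real (j div 3 + 1) powr s"
    and K_def: "K = closure (convex hull (range (\<lambda>j. circ (\<phi>0 + \<theta> j)) \<union> range (\<lambda>j. circ (\<phi>0 + pi + \<theta> j))))"
begin

definition limit_angle :: real where
  "limit_angle = 3 * (\<Sum>i. C / real (Suc i) powr s)"

lemma gaps_summable: "summable (\<lambda>i. C / real (Suc i) powr s)"
proof -
  have "summable (\<lambda>i. real (Suc i) powr (- s))"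
    using s by (subst summable_Suc_iff) (simp add: summable_real_powr_iff)
  then have "summable (\<lambda>i. C * real (Suc i) powr (- s))" by (rule summable_mult)
  then show ?thesis by (simp add: powr_minus divide_inverse)
qed

lemma \<theta>_triple: "\<theta> (3 * k) = 3 * (\<Sum>i<k. C / real (Suc i) powr s)"
proof (induction k)
  case (Suc k)
  have "(3 * k) div 3 = k" "Suc (3 * k) div 3 = k" "Suc (Suc (3 * k)) div 3 = k" by presburger+
  then have "\<theta> (Suc (Suc (Suc (3 * k)))) = \<theta> (3 * k) + 3 * (C / real (Suc k) powr s)"
    using \<theta>_step[of "3*k"] \<theta>_step[of "Suc (3*k)"] \<theta>_step[of "Suc (Suc (3*k))"]
    by (simp only: Suc_eq_plus1[symmetric])
  moreover have "3 * Suc k = Suc (Suc (Suc (3 * k)))" by simp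
  ultimately show ?case using Suc by (simp only: sum.lessThan_Suc distrib_left)
qed (simp add: \<theta>0)

lemma \<theta>_step_pos: "\<theta> j < \<theta> (Suc j)"
proof -
  have "0 < C / real (j div 3 + 1) powr s" using C by (intro divide_pos_pos) auto
  then show ?thesis using \<theta>_step[of j] by linarith
qed

lemma \<theta>_strict_mono: "strict_mono \<theta>"
  using \<theta>_step_pos by (simp add: strict_mono_Suc_iff)

lemma \<theta>_mono: "i \<le> j \<Longrightarrow> \<theta> i \<le> \<theta> j"
  using \<theta>_strict_mono by (simp add: strict_mono_less_eq)

lemma \<theta>_nonneg: "0 \<le> \<theta> j" using \<theta>_mono[of 0 j] \<theta>0 by simp

lemma limit_angle_less: "limit_angle < pi" using total limit_angle_def by simp

lemma \<theta>_less_limit: "\<theta> j < limit_angle"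
proof -
  have "\<theta> (Suc j) \<le> \<theta> (3 * Suc j)" by (rule \<theta>_mono) simp
  also have "\<dots> \<le> limit_angle" unfolding \<theta>_triple limit_angle_def
    by (intro mult_left_mono sum_le_suminf gaps_summable) (use C in auto)
  finally show ?thesis using \<theta>_step_pos[of j] by simp
qed

lemma \<theta>_tendsto: "\<theta> \<longlonglongrightarrow> limit_angle"
proof -
  have "(\<lambda>k. 3 * (\<Sum>i<k. C / real (Suc i) powr s)) \<longlonglongrightarrow> limit_angle"
    unfolding limit_angle_def using gaps_summable by (intro tendsto_mult tendsto_const summable_LIMSEQ)
  then have *: "(\<lambda>k. \<theta> (3 * k)) \<longlonglongrightarrow> limit_angle" by (simp add: \<theta>_triple)
  have "incseq \<theta>" using \<theta>_mono by (simp add: incseq_def)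
  then obtain L where L: "\<theta> \<longlonglongrightarrow> L"
    using incseq_convergent[of \<theta> limit_angle] \<theta>_less_limit less_imp_le by metis
  then have "(\<lambda>k. \<theta> (3 * k)) \<longlonglongrightarrow> L"
    using LIMSEQ_subseq_LIMSEQ[of \<theta> L "\<lambda>k. 3 * k"] by (simp add: strict_mono_def o_def)
  then show ?thesis using L * LIMSEQ_unique by blast
qed

lemma \<theta>_gap_square: "(\<theta> (Suc j) - \<theta> j)\<^sup>2 < 2"
proof -
  have "\<theta> (Suc j) - \<theta> j \<le> (\<Sum>i. C / real (Suc i) powr s)"
    unfolding \<theta>_step using sum_le_suminf[OF gaps_summable, of "{j div 3}"] C by simp
  then have "\<theta> (Suc j) - \<theta> j < pi / 3" using total by simp
  also have "pi / 3 \<le> 4/3" using pi_less_4 by simp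
  finally have "(\<theta> (Suc j) - \<theta> j)\<^sup>2 \<le> (4/3)\<^sup>2" using \<theta>_step_pos[of j] by (intro power_mono) auto
  then show ?thesis by (simp add: power2_eq_square)
qed

lemma K_minimal:
  assumes "closed H" "convex H" "\<And>j. circ (\<phi>0 + \<theta> j) \<in> H" "\<And>j. circ (\<phi>0 + pi + \<theta> j) \<in> H"
  shows "K \<subseteq> H"
  unfolding K_def using assms by (intro closure_minimal hull_minimal) auto

lemma K_unit: "K \<subseteq> cball 0 1"
  by (rule K_minimal) auto

lemma K_convex: "convex K" unfolding K_def by (intro convex_closure convex_convex_hull)

lemma K_compact: "compact K"
  using K_unit bounded_subset[OF bounded_cball] unfolding compact_eq_bounded_closed
  by (auto simp: K_def)

lemma vertex_mem: "circ (\<phi>0 + \<theta> j) \<in> K" "circ (\<phi>0 + pi + \<theta> j) \<in> K"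
  unfolding K_def by (auto intro!: subsetD[OF closure_subset] hull_inc)

lemma vertex_opposite: "circ (\<phi>0 + pi + \<theta> j) = - circ (\<phi>0 + \<theta> j)"
  using circ_add_pi[of "\<phi>0 + \<theta> j"] by (simp add: add_ac)

lemma K_sym: "\<forall>x\<in>K. - x \<in> K"
proof -
  have "K \<subseteq> uminus ` K"
  proof (rule K_minimal)
    show "closed (uminus ` K)" using K_compact compact_imp_closed closed_negations by blast
    show "convex (uminus ` K)" using K_convex convex_negations by blast
    show "circ (\<phi>0 + \<theta> j) \<in> uminus ` K" for j
      using vertex_mem(2)[of j] vertex_opposite[of j] by (metis image_eqI minus_minus)
    show "circ (\<phi>0 + pi + \<theta> j) \<in> uminus ` K" for j
      using vertex_mem(1)[of j] vertex_opposite[of j] by blast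
  qed
  then show ?thesis by auto
qed

lemma limit_vertex_mem: "circ (\<phi>0 + limit_angle) \<in> K"
proof (rule closed_sequentially)
  show "closed K" using K_compact compact_imp_closed by blast
  show "\<And>j. circ (\<phi>0 + \<theta> j) \<in> K" by (rule vertex_mem)
  show "(\<lambda>j. circ (\<phi>0 + \<theta> j)) \<longlonglongrightarrow> circ (\<phi>0 + limit_angle)"
  proof (rule vec_tendstoI)
    fix i :: 2
    have "(\<lambda>j. cos (\<phi>0 + \<theta> j)) \<longlonglongrightarrow> cos (\<phi>0 + limit_angle)"
      "(\<lambda>j. sin (\<phi>0 + \<theta> j)) \<longlonglongrightarrow> sin (\<phi>0 + limit_angle)"
      by (intro tendsto_intros \<theta>_tendsto)+
    then show "(\<lambda>j. circ (\<phi>0 + \<theta> j) $ i) \<longlonglongrightarrow> circ (\<phi>0 + limit_angle) $ i"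
      using exhaust_2[of i] by auto
  qed
qed

text \<open>
  A half plane contains \<open>K\<close> if it contains the vertices, that is, if all angles stay at least \<open>h\<close>
  away from the direction \<open>m\<close> of its normal, modulo a full turn.
\<close>

lemma gap_halfplane:
  assumes "0 \<le> h"
    and "\<And>j. h \<le> \<bar>\<theta> j - m\<bar> \<and> \<bar>\<theta> j - m\<bar> \<le> 2 * pi - h"
    and "\<And>j. h \<le> \<bar>\<theta> j + pi - m\<bar> \<and> \<bar>\<theta> j + pi - m\<bar> \<le> 2 * pi - h"
    and "z \<in> K"
  shows "z \<bullet> circ (\<phi>0 + m) \<le> cos h"
proof -
  have "K \<subseteq> {z. circ (\<phi>0 + m) \<bullet> z \<le> cos h}"
  proof (rule K_minimal)
    show "circ (\<phi>0 + \<theta> j) \<in> {z. circ (\<phi>0 + m) \<bullet> z \<le> cos h}" for j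
      using cos_le_cos_outside[of h "\<theta> j - m"] assms(1,2)
      by (subst inner_commute) (simp add: inner_circ)
    show "circ (\<phi>0 + pi + \<theta> j) \<in> {z. circ (\<phi>0 + m) \<bullet> z \<le> cos h}" for j
      using cos_le_cos_outside[of h "\<theta> j + pi - m"] assms(1,3)
      by (subst inner_commute) (simp add: inner_circ algebra_simps)
  qed (rule closed_halfspace_le convex_halfspace_le)+
  then show ?thesis using assms(4) by (auto simp: inner_commute)
qed

lemma gap_edge_arc: "edge_arc K (\<phi>0 + \<theta> j) (\<phi>0 + \<theta> (Suc j))"
  unfolding edge_arc_def
proof (intro conjI ballI vertex_mem)
  have r: "0 \<le> \<theta> j" "\<theta> j < \<theta> (Suc j)" "\<theta> (Suc j) < pi"
    using \<theta>_nonneg \<theta>_step_pos \<theta>_less_limit[of "Suc j"] limit_angle_less by auto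
  then show "\<phi>0 + \<theta> j < \<phi>0 + \<theta> (Suc j)" "\<phi>0 + \<theta> (Suc j) < \<phi>0 + \<theta> j + pi" by auto
  fix z assume z: "z \<in> K"
  have "z \<bullet> circ (\<phi>0 + (\<theta> j + \<theta> (Suc j)) / 2) \<le> cos ((\<theta> (Suc j) - \<theta> j) / 2)"
  proof (rule gap_halfplane[OF _ _ _ z])
    fix k
    have "\<theta> k \<le> \<theta> j \<or> \<theta> (Suc j) \<le> \<theta> k" using \<theta>_mono[of k j] \<theta>_mono[of "Suc j" k] by linarith
    moreover have "0 \<le> \<theta> k" "\<theta> k < pi" using \<theta>_nonneg \<theta>_less_limit[of k] limit_angle_less by auto
    ultimately show "(\<theta> (Suc j) - \<theta> j) / 2 \<le> \<bar>\<theta> k - (\<theta> j + \<theta> (Suc j)) / 2\<bar> \<and>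
      \<bar>\<theta> k - (\<theta> j + \<theta> (Suc j)) / 2\<bar> \<le> 2 * pi - (\<theta> (Suc j) - \<theta> j) / 2"
      "(\<theta> (Suc j) - \<theta> j) / 2 \<le> \<bar>\<theta> k + pi - (\<theta> j + \<theta> (Suc j)) / 2\<bar> \<and>
      \<bar>\<theta> k + pi - (\<theta> j + \<theta> (Suc j)) / 2\<bar> \<le> 2 * pi - (\<theta> (Suc j) - \<theta> j) / 2"
      using r by (auto simp: field_simps abs_if)
  qed (use r in simp)
  moreover have "\<phi>0 + (\<theta> j + \<theta> (Suc j)) / 2 = (\<phi>0 + \<theta> j + (\<phi>0 + \<theta> (Suc j))) / 2" by (simp add: field_simps)
  ultimately show "z \<bullet> circ ((\<phi>0 + \<theta> j + (\<phi>0 + \<theta> (Suc j))) / 2) \<le> cos ((\<phi>0 + \<theta> (Suc j) - (\<phi>0 + \<theta> j)) / 2)" by simp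
qed

text \<open>
  The angles increase to \<open>limit_angle\<close> and the next vertex is the opposite of the first one.
\<close>

lemma limit_edge_arc: "edge_arc K (\<phi>0 + limit_angle) (\<phi>0 + pi)"
  unfolding edge_arc_def
proof (intro conjI ballI limit_vertex_mem)
  have r: "0 < limit_angle" "limit_angle < pi"
    using \<theta>_less_limit[of 0] \<theta>0 limit_angle_less by auto
  then show "\<phi>0 + limit_angle < \<phi>0 + pi" "\<phi>0 + pi < \<phi>0 + limit_angle + pi" by auto
  show "circ (\<phi>0 + pi) \<in> K" using vertex_mem(2)[of 0] \<theta>0 by simp
  fix z assume z: "z \<in> K"
  have "z \<bullet> circ (\<phi>0 + (limit_angle + pi) / 2) \<le> cos ((pi - limit_angle) / 2)"
  proof (rule gap_halfplane[OF _ _ _ z])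
    fix k
    have "0 \<le> \<theta> k" "\<theta> k < limit_angle" using \<theta>_nonneg \<theta>_less_limit[of k] by auto
    then show "(pi - limit_angle) / 2 \<le> \<bar>\<theta> k - (limit_angle + pi) / 2\<bar> \<and>
      \<bar>\<theta> k - (limit_angle + pi) / 2\<bar> \<le> 2 * pi - (pi - limit_angle) / 2"
      "(pi - limit_angle) / 2 \<le> \<bar>\<theta> k + pi - (limit_angle + pi) / 2\<bar> \<and>
      \<bar>\<theta> k + pi - (limit_angle + pi) / 2\<bar> \<le> 2 * pi - (pi - limit_angle) / 2"
      using r by (auto simp: field_simps abs_if)
  qed (use r in simp)
  moreover have "\<phi>0 + (limit_angle + pi) / 2 = (\<phi>0 + limit_angle + (\<phi>0 + pi)) / 2" by (simp add: field_simps)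
  ultimately show "z \<bullet> circ ((\<phi>0 + limit_angle + (\<phi>0 + pi)) / 2) \<le> cos ((\<phi>0 + pi - (\<phi>0 + limit_angle)) / 2)" by simp
qed

lemma upper_half_covered:
  assumes "\<phi>0 \<le> \<phi>" "\<phi> < \<phi>0 + pi"
  obtains j where "\<phi>0 + \<theta> j \<le> \<phi>" "\<phi> \<le> \<phi>0 + \<theta> (Suc j)" | "\<phi>0 + limit_angle \<le> \<phi>"
proof (cases "\<phi> < \<phi>0 + limit_angle")
  case True
  then have "eventually (\<lambda>j. \<phi> - \<phi>0 < \<theta> j) sequentially"
    using \<theta>_tendsto by (intro order_tendstoD(1)[of _ limit_angle]) auto
  then have ex: "\<exists>j. \<phi> - \<phi>0 < \<theta> j" by (auto simp: eventually_sequentially)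
  define k where "k = (LEAST j. \<phi> - \<phi>0 < \<theta> j)"
  have k: "\<phi> - \<phi>0 < \<theta> k" unfolding k_def using ex by (rule LeastI_ex)
  then obtain j where j: "k = Suc j" using assms \<theta>0 by (cases k) auto
  then have "j < k" by simp
  then have "\<not> \<phi> - \<phi>0 < \<theta> j" unfolding k_def by (rule not_less_Least)
  then show ?thesis using that(1)[of j] k j by simp
next
  case False
  then show ?thesis using that(2) by simp
qed

text \<open>
  The gaps fill the angles up to \<open>limit_angle\<close>, the limit edge fills those up to \<open>\<pi>\<close>, and the rest
  follows by central symmetry.
\<close>

lemma sectors_cover:
  "(\<Union>j. sector (\<phi>0 + \<theta> j) (\<phi>0 + \<theta> (Suc j)) \<union> sector (\<phi>0 + \<theta> j + pi) (\<phi>0 + \<theta> (Suc j) + pi))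
   \<union> (sector (\<phi>0 + limit_angle) (\<phi>0 + pi) \<union> sector (\<phi>0 + limit_angle + pi) (\<phi>0 + pi + pi)) = UNIV"
  (is "?L = UNIV")
proof -
  have "x \<in> ?L" for x
  proof -
    obtain r \<phi> where x: "r \<ge> 0" "\<phi>0 \<le> \<phi>" "\<phi> < \<phi>0 + 2 * pi" "x = r *\<^sub>R circ \<phi>"
      by (rule polar_coordinates)
    have arcs: "\<phi>0 + \<theta> j < \<phi>0 + \<theta> (Suc j)" "\<phi>0 + \<theta> (Suc j) < \<phi>0 + \<theta> j + pi" for j
      using gap_edge_arc[of j] unfolding edge_arc_def by auto
    have limit_arc: "\<phi>0 + limit_angle < \<phi>0 + pi" "\<phi>0 + pi < \<phi>0 + limit_angle + pi"
      using limit_edge_arc unfolding edge_arc_def by auto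
    show ?thesis
    proof (cases "\<phi> < \<phi>0 + pi")
      case True
      then show ?thesis
      proof (rule upper_half_covered[OF x(2)])
        fix j assume "\<phi>0 + \<theta> j \<le> \<phi>" "\<phi> \<le> \<phi>0 + \<theta> (Suc j)"
        then have "x \<in> sector (\<phi>0 + \<theta> j) (\<phi>0 + \<theta> (Suc j))"
          unfolding x(4) using arcs x by (intro sector_polar) auto
        then show ?thesis by blast
      next
        assume "\<phi>0 + limit_angle \<le> \<phi>"
        then have "x \<in> sector (\<phi>0 + limit_angle) (\<phi>0 + pi)"
          unfolding x(4) using limit_arc x True by (intro sector_polar) auto
        then show ?thesis by blast
      qed
    next
      case False
      then have 1: "\<phi>0 \<le> \<phi> - pi" "\<phi> - pi < \<phi>0 + pi" using x by auto
      show ?thesis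
      proof (rule upper_half_covered[OF 1])
        fix j assume "\<phi>0 + \<theta> j \<le> \<phi> - pi" "\<phi> - pi \<le> \<phi>0 + \<theta> (Suc j)"
        then have "x \<in> sector (\<phi>0 + \<theta> j + pi) (\<phi>0 + \<theta> (Suc j) + pi)"
          unfolding x(4) using arcs[of j] x by (intro sector_polar) auto
        then show ?thesis by blast
      next
        assume "\<phi>0 + limit_angle \<le> \<phi> - pi"
        then have "x \<in> sector (\<phi>0 + limit_angle + pi) (\<phi>0 + pi + pi)"
          unfolding x(4) using limit_arc x 1 by (intro sector_polar) auto
        then show ?thesis by blast
      qed
    qed
  qed
  then show ?thesis by blast
qed

text \<open>
  The first \<open>M\<close> gaps and the limit edge, each with its opposite, are estimated by the bound that is
  independent of the length, and the remaining gaps by the linear one; their lengths telescope.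
\<close>

lemma volume_le:
  assumes \<rho>: "0 < \<rho>" "ball p \<rho> \<subseteq> K" and r: "0 < r" and n: "(1/2)^n \<le> \<rho> * exp (-2 * r)"
  defines "X \<equiv> 2 * real (n+1) * (real (n+1) * pi + 8 * pi / \<rho>)"
    and "Y \<equiv> 2 * pi * 2^(n+2) / \<rho>"
  shows "busemann_vol K (hilbert_ball K p r) \<le> ennreal (2 * (real M + 1) * X + 2 * Y * (limit_angle - \<theta> M))"
proof -
  let ?B = "hilbert_ball K p r"
  let ?S = "\<lambda>j. sector (\<phi>0 + \<theta> j) (\<phi>0 + \<theta> (Suc j)) \<union> sector (\<phi>0 + \<theta> j + pi) (\<phi>0 + \<theta> (Suc j) + pi)"
  let ?T = "sector (\<phi>0 + limit_angle) (\<phi>0 + pi) \<union> sector (\<phi>0 + limit_angle + pi) (\<phi>0 + pi + pi)"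
  note dom = hilbert_ball_sector_dominated[OF K_compact K_convex K_sym \<rho> r n, folded X_def Y_def]
  have X: "0 \<le> X" and Y: "0 \<le> Y" using \<rho> by (auto simp: X_def Y_def)
  note edge' = edge_arc_opposite[OF gap_edge_arc K_sym] and limit_edge_arc' = edge_arc_opposite[OF limit_edge_arc K_sym]
  have near: "dominated K (?B \<inter> ?S j) (ennreal (2 * X))" for j
    using dominated_Un[OF dom(1)[OF gap_edge_arc[of j]] dom(1)[OF edge'[of j]]] X
    by (simp add: Int_Un_distrib ennreal_plus[symmetric] del: ennreal_plus)
  have far: "dominated K (?B \<inter> ?S j) (ennreal (2 * Y * (\<theta> (Suc j) - \<theta> j)))" for j
  proof -
    have "0 \<le> Y * (\<theta> (Suc j) - \<theta> j)" using Y \<theta>_step_pos[of j] by simp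
    then show ?thesis
      using dominated_Un[OF dom(2)[OF gap_edge_arc[of j]] dom(2)[OF edge'[of j]]]
      by (simp add: Int_Un_distrib ennreal_plus[symmetric] mult.assoc del: ennreal_plus)
  qed
  have limit: "dominated K (?B \<inter> ?T) (ennreal (2 * X))"
    using dominated_Un[OF dom(1)[OF limit_edge_arc] dom(1)[OF limit_edge_arc']] X
    by (simp add: Int_Un_distrib ennreal_plus[symmetric] del: ennreal_plus)
  have 1: "dominated K (\<Union>j\<in>{..<M}. ?B \<inter> ?S j) (\<Sum>j\<in>{..<M}. ennreal (2 * X))"
    using near by (intro dominated_finite_UN) auto
  have 2: "dominated K (\<Union>i. ?B \<inter> ?S (i + M)) (\<Sum>i. ennreal (2 * Y * (\<theta> (Suc (i + M)) - \<theta> (i + M))))"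
    using far by (intro dominated_UN) auto
  have "(\<lambda>i. \<theta> (Suc i + M) - \<theta> (i + M)) sums (limit_angle - \<theta> (0 + M))"
    using \<theta>_tendsto by (intro telescope_sums) (rule LIMSEQ_ignore_initial_segment)
  then have "(\<lambda>i. 2 * Y * (\<theta> (Suc (i + M)) - \<theta> (i + M))) sums (2 * Y * (limit_angle - \<theta> M))"
    by (intro sums_mult) simp
  then have tail: "(\<Sum>i. ennreal (2 * Y * (\<theta> (Suc (i + M)) - \<theta> (i + M)))) = ennreal (2 * Y * (limit_angle - \<theta> M))"
    using Y \<theta>_step_pos by (intro suminf_ennreal_eq) (auto simp: less_imp_le)
  have lim_nn: "0 \<le> limit_angle - \<theta> M" using \<theta>_less_limit[of M] by simp
  have "?B \<subseteq> ((\<Union>j\<in>{..<M}. ?B \<inter> ?S j) \<union> (\<Union>i. ?B \<inter> ?S (i + M))) \<union> (?B \<inter> ?T)"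
  proof
    fix x assume x: "x \<in> ?B"
    have "x \<in> (\<Union>j. ?S j) \<union> ?T" using sectors_cover by blast
    then consider j where "x \<in> ?S j" | "x \<in> ?T" by blast
    then show "x \<in> ((\<Union>j\<in>{..<M}. ?B \<inter> ?S j) \<union> (\<Union>i. ?B \<inter> ?S (i + M))) \<union> (?B \<inter> ?T)"
    proof cases
      case 1
      show ?thesis
      proof (cases "j < M")
        case True then show ?thesis using x 1 by blast
      next
        case False
        then obtain i where i: "j = i + M" by (metis le_add_diff_inverse2 not_less)
        have "x \<in> ?B \<inter> ?S (i + M)" using x 1 unfolding i by blast
        then have "x \<in> (\<Union>i. ?B \<inter> ?S (i + M))" by (rule UN_I[OF UNIV_I])
        then show ?thesis by (intro UnI1[OF UnI2])
      qed
    qed (use x in blast)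
  qed
  then have "dominated K ?B ((\<Sum>j\<in>{..<M}. ennreal (2 * X)) + ennreal (2 * Y * (limit_angle - \<theta> M)) + ennreal (2 * X))"
    using dominated_Un[OF dominated_Un[OF 1 2[unfolded tail]] limit] dominated_mono by blast
  also have "(\<Sum>j\<in>{..<M}. ennreal (2 * X)) = ennreal (2 * real M * X)"
    using X by (subst sum_ennreal) (auto simp: mult_ac)
  also have "ennreal (2 * real M * X) + ennreal (2 * Y * (limit_angle - \<theta> M)) + ennreal (2 * X)
      = ennreal (2 * (real M + 1) * X + 2 * Y * (limit_angle - \<theta> M))"
  proof -
    have "0 \<le> 2 * real M * X" "0 \<le> 2 * Y * (limit_angle - \<theta> M)" using X Y lim_nn by auto
    then have "ennreal (2 * real M * X) + ennreal (2 * Y * (limit_angle - \<theta> M)) + ennreal (2 * X)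
        = ennreal (2 * real M * X + 2 * Y * (limit_angle - \<theta> M) + 2 * X)"
      using X by (simp only: ennreal_plus add_nonneg_nonneg mult_nonneg_nonneg zero_le_numeral)
    also have "2 * real M * X + 2 * Y * (limit_angle - \<theta> M) + 2 * X
        = 2 * (real M + 1) * X + 2 * Y * (limit_angle - \<theta> M)" by (simp add: algebra_simps)
    finally show ?thesis .
  qed
  finally show ?thesis by (rule dominated_imp_vol_le)
qed

text \<open>
  For \<open>i > N\<close> one has \<open>i powr (- s) \<le> N powr (2 - s) / i\<^sup>2\<close>, since \<open>s > 2\<close>, and the sum of
  \<open>1 / i\<^sup>2\<close> is dominated by a telescoping one.
\<close>

lemma limit_angle_gap:
  assumes N: "1 \<le> N"
  shows "limit_angle - \<theta> (3 * N) \<le> 3 * C * real N powr (1 - s)"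
proof -
  define c where "c = 3 * C * real N powr (2 - s)"
  have c: "0 \<le> c" using C by (simp add: c_def)
  have "\<theta> (3 * k) - \<theta> (3 * N) \<le> c * (1 / real N - 1 / real k)" if "N \<le> k" for k
    using that
  proof (induction k rule: dec_induct)
    case (step k)
    have k: "1 \<le> k" using step N by simp
    have "1 / real (Suc k) powr s = real (Suc k) powr (2 - s) * (1 / (real (Suc k))\<^sup>2)"
      by (simp add: powr_diff powr_numeral)
    also have "\<dots> \<le> real N powr (2 - s) * (1 / real k - 1 / real (Suc k))"
    proof (intro mult_mono)
      show "real (Suc k) powr (2 - s) \<le> real N powr (2 - s)"
        using s N step by (intro powr_mono2') auto
      show "1 / (real (Suc k))\<^sup>2 \<le> 1 / real k - 1 / real (Suc k)"
      proof -
        have "1 / (real (Suc k))\<^sup>2 \<le> 1 / (real k * real (Suc k))"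
          unfolding power2_eq_square using k by (intro frac_le mult_right_mono mult_pos_pos) auto
        also have "\<dots> = 1 / real k - 1 / real (Suc k)" using k by (simp add: field_simps)
        finally show ?thesis .
      qed
    qed auto
    finally have "3 * C * (1 / real (Suc k) powr s) \<le> 3 * C * (real N powr (2 - s) * (1 / real k - 1 / real (Suc k)))"
      using C by (intro mult_left_mono) auto
    moreover have "\<theta> (3 * Suc k) = \<theta> (3 * k) + 3 * C * (1 / real (Suc k) powr s)"
      unfolding \<theta>_triple by (simp add: algebra_simps)
    ultimately show ?case using step.IH unfolding c_def by (simp add: algebra_simps)
  qed simp
  then have gap: "\<theta> (3 * k) - \<theta> (3 * N) \<le> c * (1 / real N - 1 / real k)" if "N \<le> k" for k
    using that .
  have "\<theta> k \<le> \<theta> (3 * N) + c / real N" if "N \<le> k" for k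
  proof -
    have "c * (1 / real N - 1 / real k) \<le> c * (1 / real N)" using c by (intro mult_left_mono) auto
    then show ?thesis using gap[OF that] \<theta>_mono[of k "3 * k"] by simp
  qed
  then have "limit_angle \<le> \<theta> (3 * N) + c / real N"
    using \<theta>_tendsto by (intro LIMSEQ_le_const2[of \<theta>]) auto
  moreover have "real N powr (2 - s) / real N = real N powr (1 - s)"
    using N by (simp add: powr_diff powr_numeral field_simps power2_eq_square)
  then have "c / real N = 3 * C * real N powr (1 - s)" unfolding c_def by (metis times_divide_eq_right)
  ultimately show ?thesis by simp
qed

text \<open>
  The hypothesis on \<open>J\<close> says that the first \<open>J\<close> gaps are so large that their cells lie in the Hilbert ball.
  A cell of area at least \<open>\<alpha>\<^sup>3 / 64\<close> with density at least \<open>\<pi> / (8 \<alpha>\<^sup>3)\<close> contributes \<open>\<pi> / 512\<close>.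
\<close>

lemma volume_ge:
  assumes \<rho>: "0 < \<rho>" "ball p \<rho> \<subseteq> K" and r: "0 < r"
    and J: "64 * (real J powr s)\<^sup>2 < C\<^sup>2 * \<rho>\<^sup>2 * exp (2 * r)"
  shows "ennreal (real J * (pi / 512)) \<le> busemann_vol K (hilbert_ball K p r)"
proof -
  define g where "g j = \<theta> (Suc j) - \<theta> j" for j
  let ?S = "\<lambda>j. cap_cell (\<phi>0 + \<theta> j) (\<phi>0 + \<theta> (Suc j))"
  let ?m = "\<lambda>j. pi / (8 * (g j)^3)"
  have g: "(\<phi>0 + \<theta> (Suc j)) - (\<phi>0 + \<theta> j) = g j" "g j > 0" "(g j)\<^sup>2 < 2" for j
    using \<theta>_step_pos[of j] \<theta>_gap_square[of j] by (auto simp: g_def)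
  have b0: "ball 0 \<rho> \<subseteq> K" using ball_symmetric_convex[OF K_convex K_sym \<rho>(2)] by blast
  have "cball 0 (\<rho>/2) \<subseteq> ball (0::real^2) \<rho>" using \<rho>(1) by auto
  then have c: "0 < \<rho>/2" "cball 0 (\<rho>/2) \<subseteq> K" using b0 \<rho> by auto
  have gJ: "4 * exp (-2 * r) < \<rho> * ((g j)\<^sup>2 / 8 * (\<rho>/2))" if "j < J" for j
  proof -
    have "real (j div 3 + 1) powr s \<le> real J powr s" using s that by (intro powr_mono2) auto
    then have "(real (j div 3 + 1) powr s)\<^sup>2 \<le> (real J powr s)\<^sup>2" by (intro power_mono) auto
    then have 1: "64 * (real (j div 3 + 1) powr s)\<^sup>2 < C\<^sup>2 * \<rho>\<^sup>2 * exp (2 * r)" using J by linarith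
    define w where "w = real (j div 3 + 1) powr s"
    have "real (j div 3 + 1) > 0" by simp
    then have w: "w > 0" unfolding w_def by (simp only: powr_gt_zero)
    have "64 * w\<^sup>2 < C\<^sup>2 * \<rho>\<^sup>2 * exp (2 * r)" using 1 unfolding w_def .
    then have "64 < C\<^sup>2 * \<rho>\<^sup>2 * exp (2 * r) / w\<^sup>2" using w by (simp add: pos_less_divide_eq)
    also have "\<dots> = (g j)\<^sup>2 * \<rho>\<^sup>2 * exp (2 * r)" unfolding g_def \<theta>_step w_def[symmetric] by (simp add: power_divide)
    finally have "64 * exp (- 2 * r) < (g j)\<^sup>2 * \<rho>\<^sup>2 * exp (2 * r) * exp (- 2 * r)" by (intro mult_strict_right_mono) auto
    also have "\<dots> = (g j)\<^sup>2 * \<rho>\<^sup>2" by (simp add: exp_minus mult.assoc)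
    finally show ?thesis by (simp add: power2_eq_square mult_ac)
  qed
  have cell: "x \<in> hilbert_ball K p r \<and> ?m j \<le> busemann_density K x" if j: "j < J" and x: "x \<in> ?S j" for j x
  proof -
    obtain u v where uv: "x = u *\<^sub>R circ (\<phi>0 + \<theta> j) + v *\<^sub>R circ (\<phi>0 + \<theta> (Suc j))" "0 < u" "0 < v"
      "(g j)\<^sup>2/8 \<le> 1 - (u + v)" "1 - (u + v) \<le> (g j)\<^sup>2/4"
      using cap_cell_coords[OF x] g by metis
    note triangle = inscribed_triangle.triangle_ball[OF
      edge_arc_triangle[OF K_compact K_convex K_sym c gap_edge_arc[of j] order_refl]]
    have "0 < (g j)\<^sup>2 / 8" using g(2)[of j] by simp
    then have uv1: "u + v < 1" using uv(4) by linarith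
    have "ball x ((1 - (u + v)) * (\<rho>/2)) \<subseteq> K" unfolding uv(1) using uv uv1 by (intro triangle) auto
    moreover have "(g j)\<^sup>2/8 * (\<rho>/2) \<le> (1 - (u + v)) * (\<rho>/2)" using uv \<rho> by (intro mult_right_mono) auto
    ultimately have "ball x ((g j)\<^sup>2/8 * (\<rho>/2)) \<subseteq> K" using subset_ball by (meson order_trans)
    then have 1: "x \<in> hilbert_ball K p r"
      using ball_imp_hilbert_ball[OF K_compact K_convex K_unit \<rho> r] gJ[OF j] by blast
    have "x \<in> interior K" using 1 unfolding hilbert_ball_def by simp
    then have "pi / (8 * ((\<phi>0 + \<theta> (Suc j)) - (\<phi>0 + \<theta> j))^3) \<le> busemann_density K x"
      using uv g by (intro cap_density_ge[OF K_compact K_convex K_unit gap_edge_arc[of j] _ uv(1)]) auto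
    then show ?thesis using 1 g by simp
  qed
  have "ennreal (real J * (pi / 512)) \<le> ennreal (\<Sum>j\<in>{..<J}. ?m j * measure lebesgue (?S j))"
  proof (rule ennreal_leI)
    have "pi / 512 \<le> ?m j * measure lebesgue (?S j)" for j
    proof -
      have "(g j)^3 / 64 \<le> measure lebesgue (?S j)"
        using cap_cell_measure(2)[of "\<phi>0 + \<theta> j" "\<phi>0 + \<theta> (Suc j)"] g[of j] \<theta>_step_pos[of j] by simp
      then have "?m j * ((g j)^3 / 64) \<le> ?m j * measure lebesgue (?S j)"
        using g by (intro mult_left_mono) (auto simp: less_imp_le)
      moreover have "?m j * ((g j)^3 / 64) = pi / 512" using g(2)[of j] by simp
      ultimately show ?thesis by simp
    qed
    then have "(\<Sum>j\<in>{..<J}. pi / 512) \<le> (\<Sum>j\<in>{..<J}. ?m j * measure lebesgue (?S j))" by (intro sum_mono) auto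
    then show "real J * (pi / 512) \<le> (\<Sum>j\<in>{..<J}. ?m j * measure lebesgue (?S j))" by simp
  qed
  also have "\<dots> \<le> busemann_vol K (hilbert_ball K p r)"
  proof (rule busemann_vol_ge)
    have less: "?S i \<inter> ?S j = {}" if "i < j" for i j
      using that \<theta>_step_pos \<theta>_mono[of "Suc i" j] \<theta>_less_limit[of "Suc j"] limit_angle_less \<theta>_nonneg[of i] g(3) g(1)
      by (intro cap_cells_disjoint) auto
    show "disjoint_family_on ?S {..<J}"
      unfolding disjoint_family_on_def using less by (metis Int_commute linorder_neqE_nat)
    show "?S i \<in> lmeasurable" for i
      using cap_cell_measure(1)[of "\<phi>0 + \<theta> i" "\<phi>0 + \<theta> (Suc i)"] g[of i] \<theta>_step_pos[of i] by simp
  qed (use cell g in \<open>auto simp: less_imp_le\<close>)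
  finally show ?thesis .
qed

end

section \<open>Volume growth and entropy\<close>

context lacunary_body
begin

lemma log_volume_rate_tendsto_upper:
  "((\<lambda>r. 2 / s + ln (28 * (4 * r + c) * ((4 * r + c) * pi + d) + e) / r) \<longlongrightarrow> 2 / s) at_top"
proof -
  have "((\<lambda>r. ln (28 * (4 * r + c) * ((4 * r + c) * pi + d) + e) / r) \<longlongrightarrow> 0) at_top"
    by real_asymp
  from tendsto_add[OF tendsto_const this, of "2/s"] show ?thesis by simp
qed

text \<open>
  Here \<open>n\<close> is the least natural number with \<open>2\<^sup>-\<^sup>n \<le> \<rho> exp (- 2 r)\<close>, which grows linearly in \<open>r\<close>, and \<open>N\<close>, about
  \<open>exp (2 r / s)\<close>, balances \<open>N\<close> against \<open>exp (2 r) N powr (1 - s)\<close>.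
\<close>

lemma volume_growth_le:
  assumes \<rho>: "0 < \<rho>" "\<rho> \<le> 1" "ball p \<rho> \<subseteq> K" and r: "1 \<le> r"
  defines "L \<equiv> 4 * r + (2 - 2 * ln \<rho>)"
  shows "busemann_vol K (hilbert_ball K p r)
    \<le> ennreal (exp (2 * r / s) * (28 * L * (L * pi + 8 * pi / \<rho>) + 96 * pi * C / \<rho>\<^sup>2))"
proof -
  define N where "N = nat \<lceil>exp (2 * r / s)\<rceil>"
  define y where "y = (2 * r - ln \<rho>) / ln 2"
  define n where "n = nat \<lceil>y\<rceil>"
  define X where "X = 2 * real (n+1) * (real (n+1) * pi + 8 * pi / \<rho>)"
  define Y where "Y = 2 * pi * 2^(n+2) / \<rho>"
  have ln\<rho>: "ln \<rho> \<le> 0" using \<rho> by simp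
  have ln2: "1/2 \<le> ln (2::real)" "ln (2::real) > 0"
    using ln2_ge_two_thirds by auto
  have y: "0 \<le> y" unfolding y_def using ln\<rho> r ln2 by (intro divide_nonneg_nonneg) auto
  have yn: "y \<le> real n" "real n \<le> y + 1" unfolding n_def using y by linarith+
  have y2: "y * ln 2 = 2 * r - ln \<rho>" unfolding y_def using ln2 by simp
  have pow: "2 powr y = exp (2 * r) / \<rho>"
    unfolding powr_def using y2 \<rho> by (simp add: exp_diff)
  have n1: "(1/2)^n \<le> \<rho> * exp (- 2 * r)"
  proof -
    have "2 powr y \<le> 2 powr real n" using yn by (intro powr_mono) auto
    then have "exp (2 * r) / \<rho> \<le> 2 ^ n" using pow by (simp add: powr_realpow)
    then show ?thesis using \<rho> by (simp add: field_simps exp_minus power_divide)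
  qed
  have n2: "2 ^ n \<le> 2 * exp (2 * r) / \<rho>"
  proof -
    have "2 powr real n \<le> 2 powr (y + 1)" using yn by (intro powr_mono) auto
    also have "\<dots> = 2 * exp (2 * r) / \<rho>" using pow by (simp add: powr_add)
    finally show ?thesis by (simp add: powr_realpow)
  qed
  have nL: "real (n+1) \<le> L"
  proof -
    have "y * (1/2) \<le> 2 * r - ln \<rho>" using mult_left_mono[OF ln2(1) y] unfolding y2 .
    then have "y \<le> 2 * (2 * r - ln \<rho>)" by simp
    then show ?thesis using yn unfolding L_def by simp
  qed
  have E: "1 \<le> exp (2 * r / s)" using r s by simp
  have N: "exp (2 * r / s) \<le> real N" "real N \<le> exp (2 * r / s) + 1"
    unfolding N_def using E by linarith+
  have N1: "1 \<le> N" using N(1) E by linarith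
  have "real (3 * N) = 3 * real N" by simp
  then have M: "real (3 * N) + 1 \<le> 7 * exp (2 * r / s)" using N(2) E by linarith
  have XL: "0 \<le> X" "X \<le> 2 * L * (L * pi + 8 * pi / \<rho>)"
    unfolding X_def using nL \<rho> by (auto intro!: mult_mono add_mono)
  have gap: "limit_angle - \<theta> (3 * N) \<le> 3 * C * (exp (2 * r / s) * exp (- 2 * r))"
  proof -
    have "real N powr (1 - s) \<le> exp (2 * r / s) powr (1 - s)"
      using N(1) s by (intro powr_mono2') auto
    also have "\<dots> = exp ((1 - s) * (2 * r / s))" by (simp add: powr_def)
    also have "(1 - s) * (2 * r / s) = 2 * r / s + (- 2 * r)" using s by (simp add: field_simps)
    finally have "real N powr (1 - s) \<le> exp (2 * r / s) * exp (- 2 * r)" by (simp only: exp_add)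
    then have "3 * C * real N powr (1 - s) \<le> 3 * C * (exp (2 * r / s) * exp (- 2 * r))"
      using C by (intro mult_left_mono) auto
    then show ?thesis using limit_angle_gap[OF N1] by linarith
  qed
  have Y: "0 \<le> Y" "Y \<le> 16 * pi * exp (2 * r) / \<rho>\<^sup>2"
  proof -
    show "0 \<le> Y" using \<rho> by (simp add: Y_def)
    have "Y = 8 * pi / \<rho> * 2 ^ n" by (simp add: Y_def)
    also have "\<dots> \<le> 8 * pi / \<rho> * (2 * exp (2 * r) / \<rho>)" using n2 \<rho> by (intro mult_left_mono) auto
    finally show "Y \<le> 16 * pi * exp (2 * r) / \<rho>\<^sup>2" by (simp add: power2_eq_square)
  qed
  have "busemann_vol K (hilbert_ball K p r)
      \<le> ennreal (2 * (real (3 * N) + 1) * X + 2 * Y * (limit_angle - \<theta> (3 * N)))"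
    unfolding X_def Y_def using r by (intro volume_le[OF \<rho>(1,3) _ n1]) auto
  also have "\<dots> \<le> ennreal (exp (2 * r / s) * (28 * L * (L * pi + 8 * pi / \<rho>) + 96 * pi * C / \<rho>\<^sup>2))"
  proof (rule ennreal_leI)
    have "2 * (real (3 * N) + 1) * X \<le> 2 * (7 * exp (2 * r / s)) * (2 * L * (L * pi + 8 * pi / \<rho>))"
      using M XL by (intro mult_mono) auto
    also have "\<dots> = exp (2 * r / s) * (28 * L * (L * pi + 8 * pi / \<rho>))" by simp
    finally have near: "2 * (real (3 * N) + 1) * X \<le> \<dots>" .
    have "2 * Y * (limit_angle - \<theta> (3 * N))
       \<le> 2 * (16 * pi * exp (2 * r) / \<rho>\<^sup>2) * (3 * C * (exp (2 * r / s) * exp (- 2 * r)))"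
      using Y gap \<theta>_less_limit[of "3 * N"] by (intro mult_mono) auto
    also have "\<dots> = exp (2 * r / s) * (96 * pi * C / \<rho>\<^sup>2)" by (simp add: exp_minus)
    finally show "2 * (real (3 * N) + 1) * X + 2 * Y * (limit_angle - \<theta> (3 * N))
       \<le> exp (2 * r / s) * (28 * L * (L * pi + 8 * pi / \<rho>) + 96 * pi * C / \<rho>\<^sup>2)"
      unfolding distrib_left[of "exp (2 * r / s)"] by (rule add_mono[OF near])
  qed
  finally show ?thesis .
qed

text \<open>
  The constant \<open>\<kappa>\<close> is such that \<open>J \<le> \<kappa> exp (r / s)\<close> implies the hypothesis of \<open>volume_ge\<close>.
\<close>

lemma volume_growth_ge:
  assumes \<rho>: "0 < \<rho>" "ball p \<rho> \<subseteq> K" and r: "0 < r"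
  defines "\<kappa> \<equiv> (C * \<rho> / 16) powr (1 / s)"
  assumes large: "2 \<le> \<kappa> * exp (r / s)"
  shows "ennreal (\<kappa> * pi / 1024 * exp (r / s)) \<le> busemann_vol K (hilbert_ball K p r)"
proof -
  define J where "J = nat \<lfloor>\<kappa> * exp (r / s)\<rfloor>"
  have J: "real J \<le> \<kappa> * exp (r / s)" "\<kappa> * exp (r / s) - 1 \<le> real J"
    unfolding J_def using large by linarith+
  have \<kappa>: "0 < \<kappa>" using C \<rho> by (simp add: \<kappa>_def)
  have "real J powr s \<le> (\<kappa> * exp (r / s)) powr s" using J s by (intro powr_mono2) auto
  also have "\<dots> = \<kappa> powr s * exp (r / s) powr s" using \<kappa> by (simp add: powr_mult)
  also have "\<kappa> powr s = C * \<rho> / 16" unfolding \<kappa>_def using s C \<rho> by (simp add: powr_powr)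
  also have "exp (r / s) powr s = exp r" using s by (simp add: powr_def)
  finally have "(real J powr s)\<^sup>2 \<le> (C * \<rho> / 16 * exp r)\<^sup>2" by (intro power_mono) auto
  also have "\<dots> = C\<^sup>2 * \<rho>\<^sup>2 * exp (2 * r) / 256"
    by (simp add: power_mult_distrib power_divide exp_double)
  finally have "64 * (real J powr s)\<^sup>2 \<le> C\<^sup>2 * \<rho>\<^sup>2 * exp (2 * r) / 4" by simp
  also have "\<dots> < C\<^sup>2 * \<rho>\<^sup>2 * exp (2 * r)" using C \<rho> by simp
  finally have "ennreal (real J * (pi / 512)) \<le> busemann_vol K (hilbert_ball K p r)"
    by (rule volume_ge[OF \<rho> r])
  moreover have "\<kappa> * pi / 1024 * exp (r / s) \<le> real J * (pi / 512)"
  proof -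
    have "\<kappa> * exp (r / s) / 2 \<le> real J" using J large by linarith
    then have "\<kappa> * exp (r / s) / 2 * (pi / 512) \<le> real J * (pi / 512)" by (intro mult_right_mono) auto
    then show ?thesis by simp
  qed
  ultimately show ?thesis by (meson ennreal_leI order_trans)
qed

lemma entropy_bounds:
  assumes p: "p \<in> interior K"
  shows "ereal (1 / s) \<le> lower_entropy K p" "upper_entropy K p \<le> ereal (2 / s)"
proof -
  obtain \<rho>' where \<rho>': "0 < \<rho>'" "ball p \<rho>' \<subseteq> K" using p mem_interior by blast
  define \<rho> where "\<rho> = min \<rho>' 1"
  have "ball p \<rho> \<subseteq> ball p \<rho>'" by (rule subset_ball) (simp add: \<rho>_def)
  then have \<rho>: "0 < \<rho>" "\<rho> \<le> 1" "ball p \<rho> \<subseteq> K" using \<rho>' by (auto simp: \<rho>_def)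
  define \<kappa> where "\<kappa> = (C * \<rho> / 16) powr (1 / s)"
  have \<kappa>: "0 < \<kappa>" using C \<rho> by (simp add: \<kappa>_def)
  define c where "c = 2 - 2 * ln \<rho>"
  define U where "U r = 28 * (4 * r + c) * ((4 * r + c) * pi + 8 * pi / \<rho>) + 96 * pi * C / \<rho>\<^sup>2" for r
  define V where "V r = enn2real (busemann_vol K (hilbert_ball K p r))" for r
  have rate: "log_vol_rate K p r = ln (V r) / r" for r by (simp add: log_vol_rate_def V_def)
  have "filterlim (\<lambda>r. \<kappa> * exp (r / s)) at_top at_top"
  proof -
    have "filterlim (\<lambda>r. 1 / s * r) at_top at_top"
      using s by (intro filterlim_tendsto_pos_mult_at_top[OF tendsto_const] filterlim_ident) auto
    then have "filterlim (\<lambda>r. exp (r / s)) at_top at_top"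
      using filterlim_compose[OF exp_at_top] by fastforce
    then show ?thesis using \<kappa> by (intro filterlim_tendsto_pos_mult_at_top[OF tendsto_const])
  qed
  then have ev: "eventually (\<lambda>r. 2 \<le> \<kappa> * exp (r / s) \<and> 1 \<le> r) at_top"
    by (intro eventually_conj eventually_ge_at_top) (auto simp: filterlim_at_top)
  have V: "ln (V r) / r \<le> 2 / s + ln (U r) / r \<and> 1 / s + ln (\<kappa> * pi / 1024) / r \<le> ln (V r) / r"
    if r: "2 \<le> \<kappa> * exp (r / s)" "1 \<le> r" for r
  proof -
    have up: "busemann_vol K (hilbert_ball K p r) \<le> ennreal (exp (2 * r / s) * U r)"
      unfolding U_def c_def using volume_growth_le[OF \<rho> r(2)] by simp
    have fin: "busemann_vol K (hilbert_ball K p r) < top" using up by (meson ennreal_less_top le_less_trans)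
    have "0 < \<kappa> * pi / 1024 * exp (r / s)" using \<kappa> by simp
    moreover have "ennreal (\<kappa> * pi / 1024 * exp (r / s)) \<le> busemann_vol K (hilbert_ball K p r)"
      unfolding \<kappa>_def using r by (intro volume_growth_ge \<rho>) (auto simp: \<kappa>_def)
    then have lo: "\<kappa> * pi / 1024 * exp (r / s) \<le> V r"
      unfolding V_def using enn2real_mono[OF _ fin] calculation by fastforce
    ultimately have V0: "0 < V r" by linarith
    have "ln \<rho> \<le> 0" using \<rho> by simp
    then have "0 \<le> c" unfolding c_def by simp
    then have U0: "0 < U r" unfolding U_def using r(2) \<rho> C by (intro add_nonneg_pos mult_nonneg_nonneg) auto
    have "V r \<le> exp (2 * r / s) * U r"
      unfolding V_def using enn2real_mono[OF up] U0 by simp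
    then have "ln (V r) \<le> ln (exp (2 * r / s) * U r)" using V0 by (intro ln_mono) auto
    also have "\<dots> = 2 * r / s + ln (U r)" using U0 by (simp add: ln_mult)
    finally have "ln (V r) / r \<le> (2 * r / s + ln (U r)) / r" using r by (intro divide_right_mono) auto
    also have "\<dots> = 2 / s + ln (U r) / r" using r s by (simp add: add_divide_distrib)
    finally have 1: "ln (V r) / r \<le> 2 / s + ln (U r) / r" .
    have "ln (\<kappa> * pi / 1024 * exp (r / s)) \<le> ln (V r)" using lo \<kappa> by (intro ln_mono) auto
    moreover have "ln (\<kappa> * pi / 1024 * exp (r / s)) = ln (\<kappa> * pi / 1024) + r / s"
      using \<kappa> by (subst ln_mult) auto
    ultimately have "(ln (\<kappa> * pi / 1024) + r / s) / r \<le> ln (V r) / r" using r by (intro divide_right_mono) auto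
    moreover have "(ln (\<kappa> * pi / 1024) + r / s) / r = 1 / s + ln (\<kappa> * pi / 1024) / r"
      using r s by (simp add: add_divide_distrib)
    ultimately show ?thesis using 1 by simp
  qed
  have "((\<lambda>r. 1 / s + ln (\<kappa> * pi / 1024) / r) \<longlongrightarrow> 1 / s + 0) at_top"
    by (intro tendsto_intros tendsto_divide_0[OF tendsto_const] filterlim_at_top_imp_at_infinity filterlim_ident)
  then have "Liminf at_top (\<lambda>r. ereal (1 / s + ln (\<kappa> * pi / 1024) / r)) = ereal (1 / s)"
    by (intro lim_imp_Liminf) auto
  moreover have "Liminf at_top (\<lambda>r. ereal (1 / s + ln (\<kappa> * pi / 1024) / r)) \<le> lower_entropy K p"
    unfolding lower_entropy_def rate using ev V by (intro Liminf_mono) (auto elim: eventually_mono)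
  ultimately show "ereal (1 / s) \<le> lower_entropy K p" by simp
  have "((\<lambda>r. 2 / s + ln (U r) / r) \<longlongrightarrow> 2 / s) at_top"
    unfolding U_def by (rule log_volume_rate_tendsto_upper)
  then have "Limsup at_top (\<lambda>r. ereal (2 / s + ln (U r) / r)) = ereal (2 / s)"
    by (intro lim_imp_Limsup) auto
  moreover have "upper_entropy K p \<le> Limsup at_top (\<lambda>r. ereal (2 / s + ln (U r) / r))"
    unfolding upper_entropy_def rate using ev V by (intro Limsup_mono) (auto elim: eventually_mono)
  ultimately show "upper_entropy K p \<le> ereal (2 / s)" by simp
qed

end

theorem theorem3p5:
  fixes s C :: real and \<alpha> \<theta> :: "nat \<Rightarrow> real"
    and Q :: "real^2^2" and E\<^sub>0 E K :: "(real^2) set" and p :: "real^2"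
  assumes "s > 2" and "C > 0"
    and "\<And>i. i \<ge> 1 \<Longrightarrow> \<alpha> i = C / real i powr s"
    and "3 * (\<Sum>i. \<alpha> (Suc i)) < pi"
    and "\<theta> 0 = 0"
    and "\<And>j. \<theta> (Suc j) - \<theta> j = \<alpha> (j div 3 + 1)"
    and "E\<^sub>0 = range (\<lambda>j. vector [cos (\<theta> j), sin (\<theta> j)])"
    and "rotation_matrix Q"
    and "E = (\<lambda>x. Q *v x) ` (E\<^sub>0 \<union> uminus ` E\<^sub>0)"
    and "K = closure (convex hull E)"
    and "p \<in> interior K"
  shows "0 < 1 / s \<and>
         ereal (1 / s) \<le> lower_entropy K p \<and>
         lower_entropy K p \<le> upper_entropy K p \<and>
         upper_entropy K p \<le> ereal ((2 * s - 2) / (3 * s - 4)) \<and>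
         (2 * s - 2) / (3 * s - 4) < 1"
proof -
  obtain \<phi>0 where rot: "\<And>\<phi>. Q *v circ \<phi> = circ (\<phi>0 + \<phi>)"
    using rotation_matrix_circ[OF assms(8)] by blast
  have E0: "E\<^sub>0 = range (\<lambda>j. circ (\<theta> j))" using assms(7) by (simp add: circ_def)
  have opp: "- circ (\<theta> j) = circ (pi + \<theta> j)" for j using circ_add_pi[of "\<theta> j"] by (simp add: add.commute)
  have E: "E = range (\<lambda>j. circ (\<phi>0 + \<theta> j)) \<union> range (\<lambda>j. circ (\<phi>0 + pi + \<theta> j))"
    unfolding assms(9) E0 image_Un image_image opp rot by (simp add: add.assoc)
  interpret lacunary_body s C \<phi>0 \<theta> K
  proof unfold_locales
    show "3 * (\<Sum>i. C / real (Suc i) powr s) < pi" using assms(3,4) by simp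
    show "\<theta> (Suc j) - \<theta> j = C / real (j div 3 + 1) powr s" for j using assms(3,6) by simp
    show "K = closure (convex hull (range (\<lambda>j. circ (\<phi>0 + \<theta> j)) \<union> range (\<lambda>j. circ (\<phi>0 + pi + \<theta> j))))"
      using assms(10) E by simp
  qed (use assms in auto)
  \<comment> \<open>The volume growth bound is stronger than required; the two rates agree only at \<open>s = 2\<close>.\<close>
  have "2 / s \<le> (2 * s - 2) / (3 * s - 4)"
  proof -
    have "0 \<le> (s - 2)\<^sup>2" by simp
    then have "2 * (3 * s - 4) \<le> (2 * s - 2) * s" by (simp add: power2_eq_square algebra_simps)
    then show ?thesis using assms(1) by (simp add: divide_simps)
  qed
  then have "upper_entropy K p \<le> ereal ((2 * s - 2) / (3 * s - 4))"
    using entropy_bounds(2)[OF assms(11)] by (meson ereal_less_eq(3) order_trans)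
  moreover have "lower_entropy K p \<le> upper_entropy K p"
    unfolding lower_entropy_def upper_entropy_def by (intro Liminf_le_Limsup) simp
  moreover have "(2 * s - 2) / (3 * s - 4) < 1" using assms(1) by (simp add: divide_simps)
  ultimately show ?thesis using entropy_bounds(1)[OF assms(11)] assms(1) by simp
qed

end
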